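(* Let $n\ge1$, let $Q$ be a real quadratic form on $\mathbb{R}^n$, and let $p_0>(2n+2)/n$. Assume that there is a constant $C$ such that $$\|\mathcal{E}g\|_{L^{p_0}(\mathbb{R}^{n+1})}\le C\,\|g\|_{\infty}\qquad\text{for all } g\in D.$$ Then for all $p>p_0$ there is a constant $C'$ such that $$\|\mathcal{E}g\|_{L^{p}(\mathbb{R}^{n+1})}\le C'\,\|g\|_{L^p(S)}\qquad\text{for all } g\in L^p(S).$$
   Context: Let $\Omega=[0,1]^n$. $Q$ is an arbitrary quadratic form on $\mathbb{R}^n$ (no restriction on signature or eigenvalues), and $S=\{(\xi,Q(\xi)):\xi\in\Omega\}$. Functions on $S$ are identified with functions on $\Omega$, and $L^q(S)$ means $L^q(\Omega)$ with Lebesgue measure. The extension operator is $$\mathcal{E}(f)(x,t)=\int_\Omega f(\xi)\,e^{i(x\cdot\xi+tQ(\xi))}\,d\xi,\qquad (x,t)\in\mathbb{R}^n\times\mathbb{R}.$$ $D\subset L^\infty(S)$ is the set of measurable functions $f:\Omega\to\{0\}\cup\{z\in\mathbb{C}:|z|=1\}$. *)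

theory Defs
  imports "HOL-Analysis.Analysis" "HOL-Probability.Essential_Supremum"
begin

definition quadratic_form :: "('a::real_vector \<Rightarrow> real) \<Rightarrow> bool"
  where "quadratic_form Q \<longleftrightarrow> (\<exists>B. bilinear B \<and> (\<forall>x. Q x = B x x))"

text \<open>
  The norms below are extended-real valued and the exponent ranges over the extended reals
  as well; only exponents \<open>p > 0\<close> are meaningful.
\<close>

definition ennreal_powr :: "ennreal \<Rightarrow> real \<Rightarrow> ennreal"
  where "ennreal_powr x a = (if x = \<infinity> then \<infinity> else ennreal (enn2real x powr a))"

definition Lp_norm :: "ennreal \<Rightarrow> 'a measure \<Rightarrow> ('a \<Rightarrow> complex) \<Rightarrow> ennreal"
  where "Lp_norm p M f =
    (if p = \<infinity> then esssup M (\<lambda>x. ennreal (norm (f x)))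
     else ennreal_powr (\<integral>\<^sup>+ x. ennreal (norm (f x) powr enn2real p) \<partial>M) (1 / enn2real p))"

definition Lp_space :: "ennreal \<Rightarrow> 'a measure \<Rightarrow> ('a \<Rightarrow> complex) set"
  where "Lp_space p M = {f \<in> borel_measurable M. Lp_norm p M f < \<infinity>}"

definition unit_cube :: "(real ^ 'n) set"
  where "unit_cube = cbox 0 1"

text \<open>
  Functions on the surface \<open>S = {(\<xi>, Q \<xi>) | \<xi> \<in> [0,1]\<^sup>n}\<close> are identified with functions on the
  cube, so \<open>L\<^sup>q(S)\<close> is taken with respect to Lebesgue measure on the cube. Such a function is
  represented by a total function on \<open>real ^ 'n\<close> of which only the values on the cube matter.
\<close>

abbreviation cube_measure :: "(real ^ 'n) measure"
  where "cube_measure \<equiv> lebesgue_on unit_cube"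

definition extension_op ::
    "(real ^ 'n \<Rightarrow> real) \<Rightarrow> (real ^ 'n \<Rightarrow> complex) \<Rightarrow> (real ^ 'n) \<times> real \<Rightarrow> complex"
  where "extension_op Q f = (\<lambda>(x, t).
    LINT \<xi>|cube_measure. f \<xi> * exp (\<i> * complex_of_real (x \<bullet> \<xi> + t * Q \<xi>)))"

definition zero_or_unimodular :: "(real ^ 'n \<Rightarrow> complex) set"
  where "zero_or_unimodular =
    {f \<in> borel_measurable cube_measure. \<forall>\<xi>\<in>unit_cube. f \<xi> = 0 \<or> norm (f \<xi>) = 1}"

end

theory Submission imports Defs
begin

text \<open>
  Averaging two unimodular functions extends the hypothesis to all functions bounded by 1, so
  \<open>E\<close> maps \<open>L\<^sup>\<infinity>\<close> to \<open>L\<^bsup>p\<^sub>0\<^esup>\<close>. Together with \<open>\<parallel>E g\<parallel>\<^sub>\<infinity> \<le> \<parallel>g\<parallel>\<^sub>1\<close> and a decomposition into dyadic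
  layers this gives \<open>L\<^sup>q \<rightarrow> L\<^sup>p\<close> bounds for \<open>p > p\<^sub>0\<close> and large \<open>q\<close>. The gain to \<open>q = p\<close> comes from the
  Galilean symmetry: a translation of \<open>g\<close> changes \<open>E g\<close> only by a measure preserving shear and a
  phase. Given \<open>\<bar>g\<bar> \<le> 1\<^sub>A\<close>, choose one after another \<open>N \<approx> 1/\<bar>A\<bar>\<close> translates of \<open>g\<close>, each with a sign.
  The signs are chosen by Clarkson's inequality, so that \<open>\<parallel>E F\<parallel>\<^sub>p\<^sup>p \<ge> N \<parallel>E g\<parallel>\<^sub>p\<^sup>p\<close> for the signed sum
  \<open>F\<close>. The translations are chosen so that each one raises \<open>\<integral> exp \<bar>F\<bar>\<close> at most by a factor
  \<open>1 + O(\<bar>A\<bar>)\<close>, which is possible on average, so \<open>\<parallel>F\<parallel>\<^sub>q = O(1)\<close>. Hence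
  \<open>\<parallel>E g\<parallel>\<^sub>p\<^sup>p = O(\<bar>A\<bar>)\<close>, and a second decomposition into dyadic layers gives the strong type bound.
\<close>

section \<open>Quadratic forms and changes of variables\<close>

text \<open>The cross terms \<open>B \<xi> \<eta> + B \<eta> \<xi>\<close> are linear in
  \<open>\<xi>\<close>, hence the inner product with a fixed vector \<open>v\<close>. This
  \<open>v\<close> becomes the direction of the shear in
  \<open>power_integral_ext_translate\<close>.\<close>

lemma quadratic_form_add:
  fixes Q :: "'a::euclidean_space \<Rightarrow> real"
  assumes "quadratic_form Q"
  obtains v where "\<And>\<xi>. Q (\<xi> + \<eta>) = Q \<xi> + v \<bullet> \<xi> + Q \<eta>"
proof -
  obtain B where B: "bilinear B" "\<And>x. Q x = B x x"
    using assms unfolding quadratic_form_def by blast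
  define l where "l \<xi> = B \<xi> \<eta> + B \<eta> \<xi>" for \<xi>
  have "linear l"
    unfolding l_def using B(1) by (intro linear_compose_add) (auto simp: bilinear_def)
  then have "l \<xi> = adjoint l 1 \<bullet> \<xi>" for \<xi>
    using adjoint_works[of l \<xi> 1] by (simp add: inner_commute)
  moreover have "Q (\<xi> + \<eta>) = Q \<xi> + l \<xi> + Q \<eta>" for \<xi>
    by (simp add: B l_def bilinear_ladd bilinear_radd)
  ultimately show thesis
    using that by metis
qed

lemma quadratic_form_scaleR:
  assumes "quadratic_form Q"
  shows "Q (c *\<^sub>R \<xi>) = c\<^sup>2 * Q \<xi>"
  using assms by (auto simp: quadratic_form_def bilinear_lmul bilinear_rmul power2_eq_square)

lemma quadratic_form_borel_measurable [measurable]: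
  fixes Q :: "'a::euclidean_space \<Rightarrow> real"
  assumes "quadratic_form Q"
  shows "Q \<in> borel_measurable borel"
proof -
  obtain B where B: "bilinear B" "\<And>x. Q x = B x x"
    using assms unfolding quadratic_form_def by blast
  have "continuous_on UNIV (\<lambda>x. B x x)"
    by (rule bilinear_continuous_on_compose[OF continuous_on_id continuous_on_id B(1)])
  then show ?thesis
    using B(2) by (simp add: borel_measurable_continuous_onI cong: measurable_cong)
qed

lemma lborel_integral_translate:
  fixes f :: "'a::euclidean_space \<Rightarrow> 'b::{banach, second_countable_topology}"
  assumes [measurable]: "f \<in> borel_measurable borel"
  shows "(LINT x|lborel. f (c + x)) = (LINT x|lborel. f x)"
proof -
  have "(LINT x|lborel. f x) = (LINT x|distr lborel borel ((+) c). f x)"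
    by (simp only: lborel_distr_plus)
  then show ?thesis
    by (simp add: integral_distr)
qed

lemma lborel_nn_integral_translate:
  fixes f :: "'a::euclidean_space \<Rightarrow> ennreal"
  assumes [measurable]: "f \<in> borel_measurable borel"
  shows "(\<integral>\<^sup>+ x. f (c + x) \<partial>lborel) = (\<integral>\<^sup>+ x. f x \<partial>lborel)"
proof -
  have "(\<integral>\<^sup>+ x. f x \<partial>lborel) = (\<integral>\<^sup>+ x. f x \<partial>distr lborel borel ((+) c))"
    by (simp only: lborel_distr_plus)
  then show ?thesis
    by (simp add: nn_integral_distr)
qed

lemma lborel_nn_integral_scaleR:
  fixes f :: "'a::euclidean_space \<Rightarrow> ennreal"
  assumes [measurable]: "f \<in> borel_measurable borel" and "c > 0"
  shows "(\<integral>\<^sup>+ x. f x \<partial>lborel) = ennreal (c ^ DIM('a)) * (\<integral>\<^sup>+ x. f (c *\<^sub>R x) \<partial>lborel)"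
  using assms(2)
  by (subst lborel_affine[of c 0])
     (auto simp: nn_integral_density nn_integral_distr nn_integral_cmult ennreal_power)

lemma lborel_integral_scaleR:
  fixes f :: "'a::euclidean_space \<Rightarrow> complex"
  assumes [measurable]: "f \<in> borel_measurable borel" and "c > 0"
  shows "(LINT x|lborel. f x) = c ^ DIM('a) * (LINT x|lborel. f (c *\<^sub>R x))"
  using assms(2)
  by (subst lborel_affine[of c 0])
     (auto simp: integral_density integral_distr scaleR_conv_of_real)

lemma cis_borel_measurable [measurable]: "cis \<in> borel_measurable borel"
  by (intro borel_measurable_continuous_onI continuous_intros)

text \<open>
  Integration over the whole space keeps translates and dilates of functions on the cube in the
  domain of the operator.
\<close>

definition ext :: "(real ^ 'n \<Rightarrow> real) \<Rightarrow> (real ^ 'n \<Rightarrow> complex) \<Rightarrow> (real ^ 'n) \<times> real \<Rightarrow> complex"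
  where "ext Q f = (\<lambda>(x, t). LINT \<xi>|lborel. f \<xi> * cis (x \<bullet> \<xi> + t * Q \<xi>))"

text \<open>The p-th power of the norm instead of the norm itself: Clarkson's inequality and the sum
  over dyadic layers are additive in it, and no roots occur before the final theorem.\<close>

definition power_integral :: "real \<Rightarrow> ('a::euclidean_space \<Rightarrow> complex) \<Rightarrow> ennreal"
  where "power_integral p h = (\<integral>\<^sup>+ z. ennreal (norm (h z) powr p) \<partial>lborel)"

lemma power_integral_cmult:
  assumes [measurable]: "h \<in> borel_measurable borel"
  shows "power_integral p (\<lambda>z. c * h z) = ennreal (norm c powr p) * power_integral p h"
  unfolding power_integral_def
  by (simp add: norm_mult powr_mult ennreal_mult nn_integral_cmult)

section \<open>Inequalities for powers, and Clarkson's inequality\<close>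

text \<open>For \<open>r\<close> equal to \<open>s\<close> or \<open>t\<close>, write r^q = r
  r^(q-1) and enlarge the second factor to (s+t)^(q-1); the two bounds add up to (s+t)^q.\<close>

lemma powr_superadditive:
  fixes s t q :: real
  assumes "s \<ge> 0" "t \<ge> 0" "q \<ge> 1"
  shows "s powr q + t powr q \<le> (s + t) powr q"
proof (cases "s + t = 0")
  case False
  then have pos: "s + t > 0" using assms by simp
  have *: "r powr q \<le> r * (s + t) powr (q - 1)" if "0 \<le> r" "r \<le> s + t" for r
  proof -
    have "r powr q = r * r powr (q - 1)"
      using that by (cases "r = 0") (auto simp: powr_diff)
    also have "\<dots> \<le> r * (s + t) powr (q - 1)"
      using that assms by (intro mult_left_mono powr_mono2) auto
    finally show ?thesis .
  qed
  have "s powr q + t powr q \<le> (s + t) * (s + t) powr (q - 1)"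
    using *[of s] *[of t] assms by (simp add: distrib_right)
  also have "\<dots> = (s + t) powr q"
    using pos by (simp add: powr_diff)
  finally show ?thesis .
qed (use assms in \<open>simp add: add_nonneg_eq_0_iff\<close>)

lemma powr_midpoint_le:
  fixes s t q :: real
  assumes "s \<ge> 0" "t \<ge> 0" "q \<ge> 1"
  shows "2 * ((s + t) / 2) powr q \<le> s powr q + t powr q"
\<comment> \<open>Convexity is applied on the open half line \<open>{0<..}\<close>, so a vanishing
  argument is treated directly, by 2 \<le> 2^q.\<close>
proof (cases "s = 0 \<or> t = 0")
  case True
  have "2 * (r / 2) powr q \<le> r powr q" if "r \<ge> 0" for r
  proof -
    have "2 powr 1 \<le> (2::real) powr q" using assms by (intro powr_mono) auto
    then have "2 * r powr q \<le> 2 powr q * r powr q"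
      by (intro mult_right_mono) auto
    then show ?thesis
      using that by (simp add: powr_divide field_simps)
  qed
  with True assms show ?thesis by auto
next
  case False
  then have "s \<in> {0<..}" "t \<in> {0<..}" using assms by auto
  from convex_onD[OF powr_convex[OF \<open>q \<ge> 1\<close>], of "1/2" s t] this
  show ?thesis by (simp add: field_simps)
qed

text \<open>With q = p/2, superadditivity bounds |a|^p + |b|^p by (|a|^2 + |b|^2)^q. By the
  parallelogram law the base is the mean of |a+b|^2 and |a-b|^2, and convexity of the q-th power
  concludes.\<close>

lemma clarkson_inequality:
  fixes a b :: "'a::real_inner"
  assumes "p \<ge> 2"
  shows "2 * (norm a powr p + norm b powr p) \<le> norm (a + b) powr p + norm (a - b) powr p"
proof -
  define q where "q = p / 2"
  have q: "q \<ge> 1" using assms by (simp add: q_def)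
  have pq: "norm x powr p = ((norm x)\<^sup>2) powr q" for x :: 'a
    by (cases "x = 0") (simp_all add: q_def powr_powr flip: powr_numeral)
  have par: "(norm (a + b))\<^sup>2 + (norm (a - b))\<^sup>2 = 2 * ((norm a)\<^sup>2 + (norm b)\<^sup>2)"
    by (simp add: power2_norm_eq_inner inner_add_left inner_add_right inner_diff_left inner_diff_right inner_commute)
  have "2 * (norm a powr p + norm b powr p) \<le> 2 * ((norm a)\<^sup>2 + (norm b)\<^sup>2) powr q"
    unfolding pq using powr_superadditive[of "(norm a)\<^sup>2" "(norm b)\<^sup>2" q] q by simp
  also have "\<dots> \<le> norm (a + b) powr p + norm (a - b) powr p"
    unfolding pq using powr_midpoint_le[of "(norm (a + b))\<^sup>2" "(norm (a - b))\<^sup>2" q] q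
    by (simp add: par del: distrib_left_numeral)
  finally show ?thesis .
qed

lemma power_integral_clarkson:
  assumes "p \<ge> 2"
    and [measurable]: "g \<in> borel_measurable borel" "h \<in> borel_measurable borel"
  shows "2 * (power_integral p g + power_integral p h) \<le>
    power_integral p (\<lambda>z. g z + h z) + power_integral p (\<lambda>z. g z - h z)"
proof -
  have "2 * (power_integral p g + power_integral p h) =
      (\<integral>\<^sup>+ z. ennreal (2 * (norm (g z) powr p + norm (h z) powr p)) \<partial>lborel)"
    unfolding power_integral_def
    by (simp add: ennreal_mult nn_integral_cmult nn_integral_add)
  also have "\<dots> \<le> (\<integral>\<^sup>+ z. ennreal (norm (g z + h z) powr p + norm (g z - h z) powr p) \<partial>lborel)"
    using clarkson_inequality[OF assms(1)] by (intro nn_integral_mono ennreal_leI) blast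
  also have "\<dots> = power_integral p (\<lambda>z. g z + h z) + power_integral p (\<lambda>z. g z - h z)"
    unfolding power_integral_def by (simp add: nn_integral_add)
  finally show ?thesis .
qed

text \<open>The weights \<open>w\<close> replace Minkowski's inequality for infinite sums.\<close>

lemma norm_powr_le_weighted_suminf:
  fixes a :: "nat \<Rightarrow> real"
  assumes "\<And>k. a k \<ge> 0" "summable a" "\<And>k. w k > 0" "summable w" "suminf w \<le> 1" "p > 0"
  shows "ennreal (suminf a powr p) \<le> (\<Sum>k. ennreal ((a k / w k) powr p))"
proof (cases "(\<Sum>k. ennreal ((a k / w k) powr p)) = top")
  case False
  define S where "S = (\<Sum>k. (a k / w k) powr p)"
  have sm: "summable (\<lambda>k. (a k / w k) powr p)"
    using False by (intro summable_suminf_not_top) auto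
  have S: "(\<Sum>k. ennreal ((a k / w k) powr p)) = ennreal S"
    unfolding S_def using sm by (intro suminf_ennreal2) auto
  have "S \<ge> 0" unfolding S_def by (intro suminf_nonneg sm) auto
  \<comment> \<open>A single term of the series is at most its sum \<open>S\<close>, so each
    a(k)/w(k) is at most S^(1/p). Summing against the weights, of total at most 1, loses
    nothing.\<close>
  have le: "a k \<le> S powr (1/p) * w k" for k
  proof -
    have "(a k / w k) powr p \<le> S"
      unfolding S_def using sum_le_suminf[OF sm, of "{k}"] by simp
    then have "((a k / w k) powr p) powr (1/p) \<le> S powr (1/p)"
      using assms(6) by (intro powr_mono2) auto
    then have "a k / w k \<le> S powr (1/p)"
      using assms(1)[of k] assms(3)[of k] assms(6) by (simp add: powr_powr)
    then show ?thesis
      using assms(3)[of k] by (simp add: field_simps)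
  qed
  have "suminf a \<le> (\<Sum>k. S powr (1/p) * w k)"
    by (intro suminf_le le assms summable_mult)
  also have "\<dots> = S powr (1/p) * suminf w"
    by (rule suminf_mult[OF assms(4)])
  also have "\<dots> \<le> S powr (1/p)"
    using assms(5) by (simp add: mult_left_le)
  finally have "suminf a powr p \<le> (S powr (1/p)) powr p"
    using assms by (intro powr_mono2 suminf_nonneg) auto
  also have "\<dots> = S"
    using \<open>S \<ge> 0\<close> assms(6) by (simp add: powr_powr)
  finally show ?thesis
    unfolding S by (rule ennreal_leI)
qed simp

text \<open>A single term of the exponential series. It lets one exponential moment control all
  moments of integer order.\<close>

lemma power_le_fact_exp:
  fixes x :: real
  assumes "x \<ge> 0"
  shows "x ^ n \<le> fact n * exp x"
proof -
  have "x ^ n /\<^sub>R fact n \<le> (\<Sum>k. x ^ k /\<^sub>R fact k)"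
    using sum_le_suminf[OF summable_exp_generic[of x], of "{n}"] assms by simp
  then show ?thesis
    by (simp add: exp_def field_simps)
qed

section \<open>The unit cube and functions supported in it\<close>

lemma emeasure_unit_cube [simp]: "emeasure lborel (unit_cube :: (real ^ 'n) set) = 1"
proof -
  have "emeasure lborel (cbox 0 1 :: (real ^ 'n) set) = ennreal (\<Prod>b\<in>Basis. (1 - 0 :: real ^ 'n) \<bullet> b)"
    by (intro emeasure_lborel_cbox) (auto simp: Basis_vec_def inner_axis)
  also have "(\<Prod>b\<in>Basis. (1 - 0 :: real ^ 'n) \<bullet> b) = 1"
    by (intro prod.neutral) (auto simp: Basis_vec_def inner_axis)
  finally show ?thesis
    by (simp add: unit_cube_def)
qed

lemma unit_cube_borel [measurable, simp]: "unit_cube \<in> sets borel"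
  by (simp add: unit_cube_def)

lemma measure_subset_unit_cube_le:
  assumes "A \<in> sets borel" "A \<subseteq> unit_cube"
  shows "measure lborel A \<le> 1" "emeasure lborel A = ennreal (measure lborel A)"
proof -
  have "emeasure lborel A \<le> 1"
    using emeasure_mono[OF assms(2), of lborel] by simp
  moreover from this show "emeasure lborel A = ennreal (measure lborel A)"
    by (intro emeasure_eq_ennreal_measure) (auto simp: top_unique)
  ultimately show "measure lborel A \<le> 1"
    by simp
qed

text \<open>For \<open>a = 0\<close> this is a bound from bounded functions on the cube to L^p. For
  \<open>a = 1\<close> it is the restricted form of L^p to L^p, because |A| is the p-th power of the
  L^p norm of the indicator of \<open>A\<close>. With \<open>^\<close> the factor at
  \<open>a = 0\<close> is 1 for null sets too, whereas \<open>0 powr 0 = 0\<close>.\<close>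

definition restricted_type ::
    "(real ^ 'n \<Rightarrow> real) \<Rightarrow> real \<Rightarrow> nat \<Rightarrow> real \<Rightarrow> bool"
  where "restricted_type Q p a C \<longleftrightarrow>
    (\<forall>g A. g \<in> borel_measurable borel \<longrightarrow> A \<in> sets borel \<longrightarrow> A \<subseteq> unit_cube \<longrightarrow>
       (\<forall>\<xi>. norm (g \<xi>) \<le> indicator A \<xi>) \<longrightarrow>
       power_integral p (ext Q g) \<le> ennreal (C * measure lborel A ^ a))"

lemma integrable_indicator_bounded:
  fixes g :: "real ^ 'n \<Rightarrow> complex"
  assumes [measurable]: "g \<in> borel_measurable borel" "A \<in> sets borel"
    and "A \<subseteq> unit_cube" "\<And>\<xi>. norm (g \<xi>) \<le> B * indicator A \<xi>"
  shows "integrable lborel g" "(LINT \<xi>|lborel. norm (g \<xi>)) \<le> B * measure lborel A"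
proof -
  have i: "integrable lborel (\<lambda>\<xi>. B * indicator A \<xi> :: real)"
    using measure_subset_unit_cube_le[OF assms(2,3)]
    by (intro integrable_mult_right integrable_real_indicator) auto
  show g: "integrable lborel g"
    by (rule Bochner_Integration.integrable_bound[OF i])
       (use assms(4) in \<open>auto intro!: AE_I2 order_trans[OF _ abs_ge_self]\<close>)
  have "(LINT \<xi>|lborel. norm (g \<xi>)) \<le> (LINT \<xi>|lborel. B * indicator A \<xi>)"
    using g i assms(4) by (intro integral_mono) auto
  then show "(LINT \<xi>|lborel. norm (g \<xi>)) \<le> B * measure lborel A"
    by simp
qed

text \<open>On the cube, which has measure 1, |g| \<le> 1 + |g|^q.\<close>

lemma integrable_powr_bounded:
  fixes g :: "real ^ 'n \<Rightarrow> complex"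
  assumes [measurable]: "g \<in> borel_measurable borel"
    and "\<And>\<xi>. \<xi> \<notin> unit_cube \<Longrightarrow> g \<xi> = 0" "q \<ge> 1"
    and "(\<integral>\<^sup>+ \<xi>. ennreal (norm (g \<xi>) powr q) \<partial>lborel) \<le> ennreal K"
  shows "integrable lborel g"
proof (rule integrableI_bounded)
  have "norm (g \<xi>) \<le> indicator unit_cube \<xi> + norm (g \<xi>) powr q" for \<xi>
  proof (cases "norm (g \<xi>) \<le> 1")
    case False
    then have "norm (g \<xi>) powr 1 \<le> norm (g \<xi>) powr q"
      using assms(3) by (intro powr_mono) auto
    with False show ?thesis by (simp add: indicator_def)
  next
    case True
    then show ?thesis
      using assms(2)[of \<xi>] powr_ge_zero[of "norm (g \<xi>)" q]
      by (cases "\<xi> \<in> unit_cube") (auto simp del: powr_ge_zero)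
  qed
  then have "(\<integral>\<^sup>+ \<xi>. ennreal (norm (g \<xi>)) \<partial>lborel) \<le>
      (\<integral>\<^sup>+ \<xi>. indicator unit_cube \<xi> + ennreal (norm (g \<xi>) powr q) \<partial>lborel)"
    by (intro nn_integral_mono) (simp flip: ennreal_indicator ennreal_plus add: ennreal_leI)
  also have "\<dots> \<le> 1 + ennreal K"
    using assms(4) by (simp add: nn_integral_add)
  also have "\<dots> < \<infinity>"
    by simp
  finally show "(\<integral>\<^sup>+ \<xi>. ennreal (norm (g \<xi>)) \<partial>lborel) < \<infinity>" .
qed simp

lemma lborel_nn_integral_reflect:
  fixes f :: "'a::euclidean_space \<Rightarrow> ennreal"
  assumes [measurable]: "f \<in> borel_measurable borel"
  shows "(\<integral>\<^sup>+ x. f (c - x) \<partial>lborel) = (\<integral>\<^sup>+ x. f x \<partial>lborel)"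
proof -
  have "(\<integral>\<^sup>+ x. f x \<partial>lborel) = (\<integral>\<^sup>+ x. f x \<partial>distr lborel borel (\<lambda>x. c - x))"
    by (subst lborel_affine[of "-1" c]) (simp_all add: density_1)
  then show ?thesis
    by (simp add: nn_integral_distr)
qed

lemma emeasure_lborel_halve:
  fixes A :: "'a::euclidean_space set"
  assumes [measurable]: "A \<in> sets borel"
  shows "emeasure lborel {\<xi>. 2 *\<^sub>R \<xi> \<in> A} = ennreal ((1/2) ^ DIM('a)) * emeasure lborel A"
proof -
  have *: "{\<xi>. 2 *\<^sub>R \<xi> \<in> A} \<in> sets borel"
    by measurable
  have "indicator {\<xi>. 2 *\<^sub>R \<xi> \<in> A} ((1/2) *\<^sub>R \<xi>) = (indicator A \<xi> :: ennreal)" for \<xi>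
    by (simp add: indicator_def)
  then have "(\<integral>\<^sup>+ \<xi>. indicator {\<xi>. 2 *\<^sub>R \<xi> \<in> A} \<xi> \<partial>lborel) =
      ennreal ((1/2) ^ DIM('a)) * (\<integral>\<^sup>+ \<xi>. indicator A \<xi> \<partial>lborel)"
    using * by (subst lborel_nn_integral_scaleR[of _ "1/2"]) (simp_all del: indicator_simps)
  then show ?thesis
    using * by simp
qed

lemma emeasure_half_cube:
  "emeasure lborel {\<xi> :: real ^ 'n. 2 *\<^sub>R \<xi> \<in> unit_cube} = ennreal ((1/2) ^ CARD('n))"
  using emeasure_lborel_halve[of "unit_cube :: (real ^ 'n) set"] by simp

section \<open>Averaging over translations\<close>

text \<open>By Fubini the overlaps integrate over all \<eta> to a w. If every \<eta> in
  \<open>H\<close> had overlap at least 2 a w / h, those \<eta> alone would contribute 2 a w. The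
  factor 2 yields a contradiction already from non-strict inequalities.\<close>

lemma ex_translate_small_overlap:
  fixes A H :: "'a::euclidean_space set" and W :: "'a \<Rightarrow> ennreal"
  assumes [measurable]: "W \<in> borel_measurable borel" "A \<in> sets borel" "H \<in> sets borel"
    and W: "(\<integral>\<^sup>+ x. W x \<partial>lborel) = ennreal w" "w > 0"
    and A: "emeasure lborel A = ennreal a" "a > 0"
    and H: "emeasure lborel H = ennreal h" "h > 0"
  obtains \<eta> where "\<eta> \<in> H" "(\<integral>\<^sup>+ x. W x * indicator A (x - \<eta>) \<partial>lborel) \<le> ennreal (2 * a * w / h)"
proof (rule ccontr)
  let ?I = "\<lambda>\<eta>. \<integral>\<^sup>+ x. W x * indicator A (x - \<eta>) \<partial>lborel"
  assume "\<not> thesis"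
  then have *: "ennreal (2 * a * w / h) \<le> ?I \<eta>" if "\<eta> \<in> H" for \<eta>
    using that \<open>\<And>\<eta>. \<eta> \<in> H \<Longrightarrow> _ \<Longrightarrow> thesis\<close>[of \<eta>] by (meson linear)
  have "ennreal (2 * a * w) = (\<integral>\<^sup>+ \<eta>. ennreal (2 * a * w / h) * indicator H \<eta> \<partial>lborel)"
    using assms by (simp add: nn_integral_cmult ennreal_mult'[symmetric])
  also have "\<dots> \<le> (\<integral>\<^sup>+ \<eta>. ?I \<eta> \<partial>lborel)"
    using * by (intro nn_integral_mono) (auto simp: indicator_def)
  also have "\<dots> = (\<integral>\<^sup>+ x. \<integral>\<^sup>+ \<eta>. W x * indicator A (x - \<eta>) \<partial>lborel \<partial>lborel)"
    by (rule lborel_pair.Fubini') measurable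
  also have "\<dots> = (\<integral>\<^sup>+ x. W x * emeasure lborel A \<partial>lborel)"
    using lborel_nn_integral_reflect[of "indicator A"] by (simp add: nn_integral_cmult)
  also have "\<dots> = ennreal (a * w)"
    using assms by (simp add: nn_integral_multc ennreal_mult mult.commute[of _ "ennreal w"] mult.commute[of a])
  finally have "2 * a * w \<le> a * w"
    using assms by (subst (asm) ennreal_le_iff) auto
  then show False
    using assms by simp
qed

text \<open>On \<open>A\<close> the exponential grows by the factor e \<le> 3 = 1 + 2. The
  right-hand side is affine in the indicator, so its integral is controlled by the overlap of the
  previous lemma.\<close>

lemma exp_add_indicator_le: "exp (s + indicator A x) \<le> exp s * (1 + 2 * indicator A x :: real)"
  using exp_le by (auto simp: indicator_def exp_add)

section \<open>Norms, the measure on the cube, and Borel representatives\<close>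

lemma ennreal_powr_le_iff:
  assumes "p > 0" "c \<ge> 0"
  shows "ennreal_powr x (1 / p) \<le> ennreal c \<longleftrightarrow> x \<le> ennreal (c powr p)"
proof (cases x)
  case (real r)
  have "r powr (1 / p) \<le> c \<longleftrightarrow> r \<le> c powr p"
    using powr_mono2[of p "r powr (1 / p)" c] powr_mono2[of "1 / p" r "c powr p"] real assms
    by (auto simp: powr_powr)
  with real assms show ?thesis
    by (simp add: ennreal_powr_def)
qed (simp add: ennreal_powr_def top_unique)

lemma borel_measurable_cube_measureI:
  "f \<in> borel_measurable borel \<Longrightarrow> f \<in> borel_measurable (cube_measure :: (real ^ 'n) measure)"
  by (simp add: measurable_completion measurable_restrict_space1)

lemma nn_integral_cube_measure:
  assumes "h \<in> borel_measurable borel" "\<And>\<xi>. \<xi> \<notin> unit_cube \<Longrightarrow> h \<xi> = 0"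
  shows "(\<integral>\<^sup>+ \<xi>. h \<xi> \<partial>cube_measure) = (\<integral>\<^sup>+ \<xi>. h \<xi> \<partial>lborel)"
proof -
  have "(\<integral>\<^sup>+ \<xi>. h \<xi> \<partial>cube_measure) = (\<integral>\<^sup>+ \<xi>. h \<xi> * indicator unit_cube \<xi> \<partial>lebesgue)"
    by (intro nn_integral_restrict_space) auto
  also have "\<dots> = (\<integral>\<^sup>+ \<xi>. h \<xi> \<partial>lebesgue)"
    using assms(2) by (intro nn_integral_cong) (auto simp: indicator_def)
  finally show ?thesis
    using assms(1) by (simp add: nn_integral_completion)
qed

text \<open>The extension by zero is Lebesgue measurable; its real and imaginary parts agree almost
  everywhere with Borel functions. This moves from Lebesgue measure on the cube to
  \<open>lborel\<close>, where the symmetries of \<open>ext\<close> are proved.\<close>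

lemma cube_measure_borel_representative:
  fixes f :: "real ^ 'n \<Rightarrow> complex"
  assumes f: "f \<in> borel_measurable cube_measure"
  obtains g where "g \<in> borel_measurable borel" "\<And>\<xi>. \<xi> \<notin> unit_cube \<Longrightarrow> g \<xi> = 0"
    "AE \<xi> in cube_measure. f \<xi> = g \<xi>"
proof -
  let ?f = "\<lambda>\<xi>. if \<xi> \<in> unit_cube then f \<xi> else 0"
  have f': "?f \<in> borel_measurable lebesgue"
    using f by (subst borel_measurable_if) auto
  have "(\<lambda>\<xi>. Re (?f \<xi>)) \<in> borel_measurable lebesgue" "(\<lambda>\<xi>. Im (?f \<xi>)) \<in> borel_measurable lebesgue"
    by (rule measurable_compose[OF f']; measurable)+
  then obtain u v where [measurable]: "u \<in> borel_measurable borel" "v \<in> borel_measurable borel"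
    and uv: "AE \<xi> in lborel. Re (?f \<xi>) = u \<xi>" "AE \<xi> in lborel. Im (?f \<xi>) = v \<xi>"
    using completion_ex_borel_measurable_real[of "\<lambda>\<xi>. Re (?f \<xi>)" lborel]
      completion_ex_borel_measurable_real[of "\<lambda>\<xi>. Im (?f \<xi>)" lborel] by auto
  let ?g = "\<lambda>\<xi>. indicator unit_cube \<xi> *\<^sub>R Complex (u \<xi>) (v \<xi>)"
  have "AE \<xi> in lborel. \<xi> \<in> unit_cube \<longrightarrow> f \<xi> = ?g \<xi>"
    using uv by eventually_elim (auto simp: complex_eq_iff)
  then have "AE \<xi> in cube_measure. f \<xi> = ?g \<xi>"
    by (simp add: AE_restrict_space_iff AE_completion)
  moreover have "?g \<in> borel_measurable borel"
    unfolding Complex_eq by measurable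
  ultimately show thesis
    by (intro that[of ?g]) auto
qed

section \<open>Linearity and symmetries of the extension operator\<close>

context
  fixes Q :: "real ^ 'n \<Rightarrow> real"
  assumes quadratic: "quadratic_form Q"
begin

lemma Q_measurable [measurable]: "Q \<in> borel_measurable borel"
  using quadratic by (rule quadratic_form_borel_measurable)

lemma integrable_mult_phase:
  assumes "integrable lborel f"
  shows "integrable lborel (\<lambda>\<xi>. f \<xi> * cis (x \<bullet> \<xi> + t * Q \<xi>))"
proof -
  have [measurable]: "f \<in> borel_measurable borel"
    using assms by auto
  show ?thesis
    by (rule Bochner_Integration.integrable_bound[OF assms]) (auto simp: norm_mult)
qed

lemma norm_ext_le: "norm (ext Q f z) \<le> (LINT \<xi>|lborel. norm (f \<xi>))"
  using integral_norm_bound[of lborel "\<lambda>\<xi>. f \<xi> * cis (fst z \<bullet> \<xi> + snd z * Q \<xi>)"]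
  by (simp add: ext_def norm_mult split_beta)

lemma ext_borel_measurable [measurable]:
  assumes [measurable]: "f \<in> borel_measurable borel"
  shows "ext Q f \<in> borel_measurable borel"
proof -
  have "(\<lambda>z. LINT \<xi>|lborel. f \<xi> * cis (fst z \<bullet> \<xi> + snd z * Q \<xi>)) \<in> borel_measurable (borel \<Otimes>\<^sub>M borel)"
    by measurable
  then show ?thesis
    by (simp add: ext_def split_beta borel_prod)
qed

lemma ext_add:
  assumes "integrable lborel f" "integrable lborel g"
  shows "ext Q (\<lambda>\<xi>. f \<xi> + g \<xi>) z = ext Q f z + ext Q g z"
  using assms by (simp add: ext_def split_beta algebra_simps integrable_mult_phase)

lemma ext_cmult: "ext Q (\<lambda>\<xi>. c * f \<xi>) z = c * ext Q f z"
  by (simp add: ext_def split_beta mult.assoc)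

lemma ext_diff:
  assumes "integrable lborel f" "integrable lborel g"
  shows "ext Q (\<lambda>\<xi>. f \<xi> - g \<xi>) z = ext Q f z - ext Q g z"
  using assms by (simp add: ext_def split_beta algebra_simps integrable_mult_phase)

lemma ext_AE_cong:
  assumes "AE \<xi> in lborel. f \<xi> = g \<xi>" "f \<in> borel_measurable borel" "g \<in> borel_measurable borel"
  shows "ext Q f = ext Q g"
proof
  fix z
  note [measurable] = assms(2,3)
  show "ext Q f z = ext Q g z"
    unfolding ext_def split_beta using assms(1) by (intro integral_cong_AE) auto
qed

text \<open>Time is the outer variable, so that a shear x + t v can be undone in the inner integral
  at fixed t.\<close>

lemma power_integral_prod:
  assumes [measurable]: "h \<in> borel_measurable borel"
  shows "power_integral p (h :: (real ^ 'n) \<times> real \<Rightarrow> complex) =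
    (\<integral>\<^sup>+ t. \<integral>\<^sup>+ x. ennreal (norm (h (x, t)) powr p) \<partial>lborel \<partial>lborel)"
proof -
  have "power_integral p h =
    (\<integral>\<^sup>+ z. ennreal (norm (h z) powr p) \<partial>(lborel \<Otimes>\<^sub>M lborel))"
    by (simp add: power_integral_def lborel_prod)
  also have "\<dots> = (\<integral>\<^sup>+ t. \<integral>\<^sup>+ x. ennreal (norm (h (x, t)) powr p) \<partial>lborel \<partial>lborel)"
    by (rule lborel_pair.nn_integral_snd[symmetric])
       (simp add: lborel_prod)
  finally show ?thesis .
qed

text \<open>Galilean symmetry: expanding the phase around \<eta> leaves a unimodular factor and
  replaces (x, t) by (x + t v, t), which translates each time slice.\<close>

lemma power_integral_ext_translate:
  assumes [measurable]: "f \<in> borel_measurable borel"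
  shows "power_integral p (ext Q (\<lambda>\<xi>. f (\<xi> - \<eta>))) = power_integral p (ext Q f)"
proof -
  obtain v where v: "\<And>\<xi>. Q (\<xi> + \<eta>) = Q \<xi> + v \<bullet> \<xi> + Q \<eta>"
    using quadratic_form_add[OF quadratic] by blast
  have "ext Q (\<lambda>\<xi>. f (\<xi> - \<eta>)) (x, t) = cis (x \<bullet> \<eta> + t * Q \<eta>) * ext Q f (t *\<^sub>R v + x, t)" for x t
  proof -
    have "ext Q (\<lambda>\<xi>. f (\<xi> - \<eta>)) (x, t) =
        (LINT \<xi>|lborel. f (\<eta> + \<xi> - \<eta>) * cis (x \<bullet> (\<eta> + \<xi>) + t * Q (\<eta> + \<xi>)))"
      unfolding ext_def split_conv by (subst lborel_integral_translate) simp_all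
    also have "\<dots> = (LINT \<xi>|lborel. cis (x \<bullet> \<eta> + t * Q \<eta>) *
        (f \<xi> * cis ((t *\<^sub>R v + x) \<bullet> \<xi> + t * Q \<xi>)))"
      by (intro Bochner_Integration.integral_cong)
         (simp_all add: add.commute[of \<eta>] v cis_mult[symmetric] algebra_simps inner_add_left inner_add_right)
    finally show ?thesis
      by (simp add: ext_def)
  qed
  then have *: "norm (ext Q (\<lambda>\<xi>. f (\<xi> - \<eta>)) (x, t)) = norm (ext Q f (t *\<^sub>R v + x, t))" for x t
    by (simp add: norm_mult)
  have "(\<integral>\<^sup>+ x. ennreal (norm (ext Q f (t *\<^sub>R v + x, t)) powr p) \<partial>lborel) =
      (\<integral>\<^sup>+ x. ennreal (norm (ext Q f (x, t)) powr p) \<partial>lborel)" for t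
    by (subst lborel_nn_integral_translate[where f="\<lambda>x. ennreal (norm (ext Q f (x, t)) powr p)"])
       simp_all
  then show ?thesis
    by (simp add: power_integral_prod * )
qed

text \<open>Parabolic scaling: doubling \<xi> is compensated by the factors 1/2 in x and 1/4 in t,
  since \<open>Q\<close> is homogeneous of degree two. The dilation moves supports into the half
  cube, which leaves room for translates.\<close>

lemma power_integral_ext_dilate:
  obtains c where "c \<ge> 0"
    "\<And>f. f \<in> borel_measurable borel \<Longrightarrow>
      power_integral p (ext Q f) = ennreal c * power_integral p (ext Q (\<lambda>\<xi>. f (2 *\<^sub>R \<xi>)))"
proof
  define n where "n = CARD('n)"
  \<comment> \<open>The Jacobians in x and t, and the p-th power of the Jacobian in \<xi>.\<close>
  let ?c = "(1/2) ^ n * (1/4) * (2 ^ n) powr p"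
  show "?c \<ge> 0" by simp
  fix f :: "real ^ 'n \<Rightarrow> complex" assume [measurable]: "f \<in> borel_measurable borel"
  let ?g = "\<lambda>\<xi>. f (2 *\<^sub>R \<xi>)"
  have "ext Q f ((1/2) *\<^sub>R x, (1/4) *\<^sub>R t) = 2 ^ n * ext Q ?g (x, t)" for x t
    unfolding ext_def split_conv n_def
    by (subst lborel_integral_scaleR[of _ 2])
       (simp_all add: quadratic_form_scaleR[OF quadratic])
  then have *: "norm (ext Q f ((1/2) *\<^sub>R x, (1/4) *\<^sub>R t)) powr p = (2 ^ n) powr p * norm (ext Q ?g (x, t)) powr p" for x t
    by (simp only: norm_mult powr_mult) (simp add: norm_power)
  have "power_integral p (ext Q f) =
      ennreal (1/4) * (\<integral>\<^sup>+ t. \<integral>\<^sup>+ x. ennreal (norm (ext Q f (x, (1/4) *\<^sub>R t)) powr p) \<partial>lborel \<partial>lborel)"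
    by (simp only: power_integral_prod ext_borel_measurable \<open>f \<in> _\<close>)
       (subst lborel_nn_integral_scaleR[of _ "1/4"], simp_all)
  also have "\<dots> = ennreal (1/4) * (\<integral>\<^sup>+ t. ennreal ((1/2)^n) * (\<integral>\<^sup>+ x. ennreal (norm (ext Q f ((1/2) *\<^sub>R x, (1/4) *\<^sub>R t)) powr p) \<partial>lborel) \<partial>lborel)"
    by (subst lborel_nn_integral_scaleR[of "\<lambda>x. ennreal (norm (ext Q f (x, _)) powr p)" "1/2"]) (simp_all add: n_def)
  also have "\<dots> = ennreal ?c * power_integral p (ext Q ?g)"
    unfolding * power_integral_prod[OF ext_borel_measurable, of ?g, simplified]
    by (simp add: nn_integral_cmult ennreal_mult mult.assoc[symmetric])
       (simp add: ennreal_mult[symmetric] mult_ac)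
  finally show "power_integral p (ext Q f) = ennreal ?c * power_integral p (ext Q ?g)" .
qed

section \<open>Summation of dyadic layers\<close>

text \<open>For h = g/B the trivial bound |E h| \<le> |A| \<le> m accounts for
  \<open>p - p\<^sub>1\<close> of the powers, and the restricted type bound for the other
  \<open>p\<^sub>1\<close>.\<close>

lemma power_integral_ext_layer:
  assumes C: "restricted_type Q p\<^sub>1 a C" "C \<ge> 0" "p\<^sub>1 < p"
    and [measurable]: "g \<in> borel_measurable borel" "A \<in> sets borel"
    and "A \<subseteq> unit_cube" "\<And>\<xi>. norm (g \<xi>) \<le> B * indicator A \<xi>" "B > 0" "measure lborel A \<le> m"
  shows "power_integral p (ext Q g) \<le> ennreal (C * B powr p * (m powr (p - p\<^sub>1) * m ^ a))"
proof -
  define h where "h \<xi> = g \<xi> / of_real B" for \<xi>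
  have [measurable]: "h \<in> borel_measurable borel"
    unfolding h_def by measurable
  have h: "norm (h \<xi>) \<le> indicator A \<xi>" for \<xi>
    using assms(7)[of \<xi>] \<open>B > 0\<close> by (simp add: h_def norm_divide field_simps)
  have m: "0 \<le> measure lborel A" "0 \<le> m"
    using assms(9) measure_nonneg[of lborel A] by linarith+
  have sup: "norm (ext Q h z) \<le> m" for z
    using norm_ext_le[of h z] integrable_indicator_bounded(2)[of h A 1] assms h by simp
  have "norm (ext Q h z) powr p \<le> m powr (p - p\<^sub>1) * norm (ext Q h z) powr p\<^sub>1" for z
  proof -
    have "norm (ext Q h z) powr p = norm (ext Q h z) powr (p - p\<^sub>1) * norm (ext Q h z) powr p\<^sub>1"
      by (simp flip: powr_add)
    also have "\<dots> \<le> m powr (p - p\<^sub>1) * norm (ext Q h z) powr p\<^sub>1"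
      using C sup by (intro mult_right_mono powr_mono2) auto
    finally show ?thesis .
  qed
  then have "power_integral p (ext Q h) \<le>
      (\<integral>\<^sup>+ z. ennreal (m powr (p - p\<^sub>1)) * ennreal (norm (ext Q h z) powr p\<^sub>1) \<partial>lborel)"
    unfolding power_integral_def by (intro nn_integral_mono) (simp flip: ennreal_mult add: ennreal_leI)
  also have "\<dots> = ennreal (m powr (p - p\<^sub>1)) * power_integral p\<^sub>1 (ext Q h)"
    unfolding power_integral_def by (simp add: nn_integral_cmult)
  also have "power_integral p\<^sub>1 (ext Q h) \<le> ennreal (C * measure lborel A ^ a)"
    using C(1) h assms(5,6) unfolding restricted_type_def by simp
  also have "\<dots> \<le> ennreal (C * m ^ a)"
    using C m assms(9) by (intro ennreal_leI mult_left_mono power_mono) auto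
  finally have *: "power_integral p (ext Q h) \<le> ennreal (m powr (p - p\<^sub>1) * (C * m ^ a))"
    using C m by (simp add: ennreal_mult mult_left_mono)
  have "g = (\<lambda>\<xi>. of_real B * h \<xi>)"
    using \<open>B > 0\<close> by (auto simp: h_def)
  then have "ext Q g = (\<lambda>z. of_real B * ext Q h z)"
    using ext_cmult[of "of_real B" h] by auto
  then have "power_integral p (ext Q g) = ennreal (B powr p) * power_integral p (ext Q h)"
    using \<open>B > 0\<close> by (simp add: power_integral_cmult)
  also have "\<dots> \<le> ennreal (B powr p) * ennreal (m powr (p - p\<^sub>1) * (C * m ^ a))"
    by (intro mult_left_mono *) auto
  finally show ?thesis
    using C m by (simp add: ennreal_mult'[symmetric] mult_ac)
qed

text \<open>The layer where |g| is about 2^k has measure O(2^(-kq)), so its power integral is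
  O(2^(kp - kq\<beta>)) with \<open>\<beta> = p - p\<^sub>1 + a\<close>. The assumption on
  \<open>q\<close> makes this decay like 2^(-k\<gamma>) with \<gamma> > 0. The lemma serves twice:
  with \<open>a = 0\<close> and large \<open>q\<close>, and with \<open>a = 1\<close> and
  \<open>q = p\<close>.\<close>

lemma restricted_type_imp_power_bounded:
  assumes C: "restricted_type Q p\<^sub>1 a C" "C \<ge> 0" "0 < p\<^sub>1" "p\<^sub>1 < p"
    and q: "q \<ge> 1" "p < q * (p - p\<^sub>1 + real a)"
  obtains C' where "C' \<ge> 0" "\<And>g. g \<in> borel_measurable borel \<Longrightarrow> (\<And>\<xi>. \<xi> \<notin> unit_cube \<Longrightarrow> g \<xi> = 0) \<Longrightarrow>
    (\<integral>\<^sup>+ \<xi>. ennreal (norm (g \<xi>) powr q) \<partial>lborel) \<le> ennreal K \<Longrightarrow>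
    power_integral p (ext Q g) \<le> ennreal C'"
proof -
  define \<beta> where "\<beta> = p - p\<^sub>1 + real a"
  define \<gamma> where "\<gamma> = q * \<beta> - p"
  \<comment> \<open>The weights \<open>w k\<close> are geometric with \<rho>^p = 2^(-\<gamma>/2).
    Dividing by them costs half of the decay 2^(-k\<gamma>) of the layers; the other half remains as
    \<sigma>^k.\<close>
  define \<rho> where "\<rho> = (2::real) powr (- \<gamma> / (2 * p))"
  define w where "w k = (1 - \<rho>) * \<rho> ^ k" for k
  define \<sigma> where "\<sigma> = (2::real) powr (- \<gamma> / 2)"
  \<comment> \<open>The 1 covers layer 0, where only |A 0| \<le> 1 is available; 2^q arises because
    |g| \<ge> 2^(k-1), not 2^k, on layer k.\<close>
  define K' where "K' = max 1 (max K 0 * 2 powr q)"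
  define m where "m k = K' * 2 powr (- (real k * q))" for k
  define D where "D = C * (1 - \<rho>) powr (- p) * K' powr \<beta>"
  have "\<beta> > 0" "\<gamma> > 0" "p > 0" "K' \<ge> 1"
    using C q by (auto simp: \<beta>_def \<gamma>_def K'_def)
  have \<rho>: "0 < \<rho>" "\<rho> < 1" and \<sigma>: "0 < \<sigma>" "\<sigma> < 1"
    using \<open>\<gamma> > 0\<close> \<open>p > 0\<close> powr_less_mono[of "- \<gamma> / (2 * p)" 0 2] powr_less_mono[of "- \<gamma> / 2" 0 2]
    by (auto simp: \<rho>_def \<sigma>_def)
  have w: "w k > 0" "summable w" "suminf w \<le> 1" for k
    using \<rho> sums_mult[OF geometric_sums[of \<rho>], of "1 - \<rho>"]
    by (auto simp: w_def[abs_def] sums_iff)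
  have "D \<ge> 0" using C by (simp add: D_def)
  show thesis
  proof
    show "D / (1 - \<sigma>) \<ge> 0"
      using \<open>D \<ge> 0\<close> \<sigma> by simp
    fix g :: "real ^ 'n \<Rightarrow> complex"
    assume [measurable]: "g \<in> borel_measurable borel" and supp: "\<And>\<xi>. \<xi> \<notin> unit_cube \<Longrightarrow> g \<xi> = 0"
      and K: "(\<integral>\<^sup>+ \<xi>. ennreal (norm (g \<xi>) powr q) \<partial>lborel) \<le> ennreal K"
    \<comment> \<open>Layer 0 collects all values below 1, and layer k > 0 those with 2^(k-1) \<le>
      |g| < 2^k.\<close>
    define \<kappa> where "\<kappa> \<xi> = (LEAST k. norm (g \<xi>) < 2 ^ k)" for \<xi>
    define A where "A k = {\<xi> \<in> unit_cube. \<kappa> \<xi> = k}" for k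
    define f where "f k \<xi> = (if \<xi> \<in> A k then g \<xi> else 0)" for k \<xi>
    have [measurable]: "\<kappa> \<in> measurable borel (count_space UNIV)"
      unfolding \<kappa>_def by measurable
    have A [measurable]: "A k \<in> sets borel" for k
    proof -
      have "A k = unit_cube \<inter> (\<kappa> -` {k} \<inter> space borel)" by (auto simp: A_def)
      moreover have "\<kappa> -` {k} \<inter> space borel \<in> sets borel"
        by (rule measurable_sets[of \<kappa> borel "count_space UNIV"]) auto
      ultimately show ?thesis
        by (metis sets.Int unit_cube_borel)
    qed
    have [measurable]: "f k \<in> borel_measurable borel" for k
      unfolding f_def by measurable
    have \<kappa>: "norm (g \<xi>) < 2 ^ \<kappa> \<xi>" for \<xi>
      unfolding \<kappa>_def by (rule LeastI_ex) (simp add: real_arch_pow)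
    have f_le: "norm (f k \<xi>) \<le> 2 ^ k * indicator (A k) \<xi>" for k \<xi>
      using \<kappa>[of \<xi>] by (auto simp: f_def A_def indicator_def)
    have Asub: "A k \<subseteq> unit_cube" for k by (auto simp: A_def)
    have f_eq: "f k \<xi> = (if k = \<kappa> \<xi> then g \<xi> else 0)" for k \<xi>
      using supp by (auto simp: f_def A_def)
    have mA: "measure lborel (A k) \<le> m k" for k
    proof (cases k)
      case 0
      then show ?thesis
        using measure_subset_unit_cube_le(1)[OF A Asub, of k] \<open>K' \<ge> 1\<close> by (simp add: m_def)
    next
      case (Suc j)
      have *: "(2 ^ j) powr q \<le> norm (g \<xi>) powr q" if "\<xi> \<in> A k" for \<xi>
        using not_less_Least[of j "\<lambda>k. norm (g \<xi>) < 2 ^ k"] that Suc q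
        by (intro powr_mono2) (auto simp: A_def \<kappa>_def)
      have "ennreal ((2 ^ j) powr q * measure lborel (A k)) =
          (\<integral>\<^sup>+ \<xi>. ennreal ((2 ^ j) powr q) * indicator (A k) \<xi> \<partial>lborel)"
        by (simp add: nn_integral_cmult ennreal_mult measure_subset_unit_cube_le(2)[OF A Asub])
      also have "\<dots> \<le> (\<integral>\<^sup>+ \<xi>. ennreal (norm (g \<xi>) powr q) \<partial>lborel)"
        using * by (intro nn_integral_mono) (auto simp: indicator_def intro!: ennreal_leI)
      also have "\<dots> \<le> ennreal (max K 0)"
        using K by (rule order_trans) (intro ennreal_leI, simp)
      finally have "(2 ^ j) powr q * measure lborel (A k) \<le> max K 0"
        by (subst (asm) ennreal_le_iff) auto
      then have "2 powr (real j * q) * measure lborel (A k) \<le> max K 0"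
        by (simp add: powr_powr flip: powr_realpow)
      then have "measure lborel (A k) \<le> max K 0 * 2 powr (- (real j * q))"
        by (simp add: powr_minus field_simps)
      also have "\<dots> = (max K 0 * 2 powr q) * 2 powr (- (real k * q))"
        by (simp add: Suc algebra_simps flip: powr_add)
      also have "\<dots> \<le> m k"
        unfolding m_def K'_def by (intro mult_right_mono) auto
      finally show ?thesis .
    qed
    have g: "integrable lborel g"
      using integrable_powr_bounded[OF _ supp q(1) K] by simp
    have f: "integrable lborel (f k)" for k
      by (rule integrable_indicator_bounded(1)[OF _ A Asub f_le]) simp
    have sum_f: "(\<Sum>k<n. norm (f k \<xi>)) \<le> norm (g \<xi>)" for n \<xi>
    proof -
      have "(\<Sum>k<n. norm (f k \<xi>)) = (\<Sum>k<n. if k = \<kappa> \<xi> then norm (g \<xi>) else 0)"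
        by (intro sum.cong) (auto simp: f_eq)
      then show ?thesis
        by (simp add: sum.delta)
    qed
    \<comment> \<open>At each point only one layer is active, so the L^1 norms of the layers sum to
      at most that of \<open>g\<close>. This justifies exchanging sum and integral in E g.\<close>
    have smf: "summable (\<lambda>k. LINT \<xi>|lborel. norm (f k \<xi>))"
    proof (rule summableI_nonneg_bounded)
      fix n
      have "(\<Sum>k<n. LINT \<xi>|lborel. norm (f k \<xi>)) = (LINT \<xi>|lborel. (\<Sum>k<n. norm (f k \<xi>)))"
        using f by (intro Bochner_Integration.integral_sum[symmetric]) auto
      also have "\<dots> \<le> (LINT \<xi>|lborel. norm (g \<xi>))"
        using f g by (intro integral_mono sum_f) auto
      finally show "(\<Sum>k<n. LINT \<xi>|lborel. norm (f k \<xi>)) \<le> (LINT \<xi>|lborel. norm (g \<xi>))" .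
    qed simp
    have sm: "summable (\<lambda>k. norm (ext Q (f k) z))" for z
      by (rule summable_comparison_test'[OF smf]) (simp add: norm_ext_le)
    have f_sums: "(\<lambda>k. f k \<xi> * c) sums (g \<xi> * c)" for \<xi> c
      using sums_mult2[OF sums_single[of "\<kappa> \<xi>" "\<lambda>_. g \<xi>"], of c] by (simp add: f_eq)
    have ext_g: "norm (ext Q g z) \<le> (\<Sum>k. norm (ext Q (f k) z))" for z
    proof -
      have "(\<lambda>k. ext Q (f k) z) sums
          (LINT \<xi>|lborel. (\<Sum>k. f k \<xi> * cis (fst z \<bullet> \<xi> + snd z * Q \<xi>)))"
        unfolding ext_def split_beta
      proof (rule sums_integral)
        show "summable (\<lambda>k. LINT \<xi>|lborel. norm (f k \<xi> * cis (fst z \<bullet> \<xi> + snd z * Q \<xi>)))"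
          using smf by (simp add: norm_mult)
        show "AE \<xi> in lborel. summable (\<lambda>k. norm (f k \<xi> * cis (fst z \<bullet> \<xi> + snd z * Q \<xi>)))"
        proof (rule AE_I2)
          fix \<xi>
          have "summable (\<lambda>k. if k = \<kappa> \<xi> then norm (g \<xi>) else 0)"
            using sums_single[of "\<kappa> \<xi>" "\<lambda>_. norm (g \<xi>)"] by (rule sums_summable)
          moreover have "(\<lambda>k. norm (f k \<xi> * cis (fst z \<bullet> \<xi> + snd z * Q \<xi>))) = (\<lambda>k. if k = \<kappa> \<xi> then norm (g \<xi>) else 0)"
            by (auto simp: f_eq norm_mult)
          ultimately show "summable (\<lambda>k. norm (f k \<xi> * cis (fst z \<bullet> \<xi> + snd z * Q \<xi>)))"
            by simp
        qed
      qed (rule integrable_mult_phase[OF f])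
      then have "(\<lambda>k. ext Q (f k) z) sums ext Q g z"
        using f_sums[THEN sums_unique, symmetric] by (simp add: ext_def split_beta)
      then show ?thesis
        using summable_norm[OF sm, of z] by (simp add: sums_iff)
    qed
    have layer: "power_integral p (\<lambda>z. ext Q (f k) z / of_real (w k)) \<le> ennreal (D * \<sigma> ^ k)" for k
    proof -
      have "power_integral p (\<lambda>z. ext Q (f k) z / of_real (w k)) =
          ennreal (w k powr (- p)) * power_integral p (ext Q (f k))"
        using power_integral_cmult[of "ext Q (f k)" p "1 / of_real (w k)"] w(1)[of k]
        by (simp add: norm_divide powr_divide powr_minus_divide)
      also have "\<dots> \<le> ennreal (w k powr (- p)) *
          ennreal (C * (2 ^ k) powr p * (m k powr (p - p\<^sub>1) * m k ^ a))"
        by (intro mult_left_mono power_integral_ext_layer[OF C(1,2,4) _ A Asub f_le _ mA]) auto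
      also have "\<dots> = ennreal (w k powr (- p) * (C * (2 ^ k) powr p * (m k powr (p - p\<^sub>1) * m k ^ a)))"
        by (rule ennreal_mult'[symmetric]) simp
      also have "w k powr (- p) * (C * (2 ^ k) powr p * (m k powr (p - p\<^sub>1) * m k ^ a)) = D * \<sigma> ^ k"
      proof -
        have "m k > 0" using \<open>K' \<ge> 1\<close> by (simp add: m_def)
        then have "m k powr (p - p\<^sub>1) * m k ^ a = m k powr \<beta>"
          by (simp add: \<beta>_def powr_add powr_realpow)
        also have "\<dots> = K' powr \<beta> * 2 powr (- (real k * q) * \<beta>)"
          using \<open>K' \<ge> 1\<close> by (simp add: m_def powr_mult powr_powr)
        finally have 1: "m k powr (p - p\<^sub>1) * m k ^ a = K' powr \<beta> * 2 powr (- (real k * q) * \<beta>)" .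
        have "w k powr (- p) = (1 - \<rho>) powr (- p) * (\<rho> powr real k) powr (- p)"
          using \<rho> by (simp add: w_def powr_mult powr_realpow)
        also have "(\<rho> powr real k) powr (- p) = 2 powr (real k * \<gamma> / 2)"
          using \<open>p > 0\<close> by (simp add: \<rho>_def powr_powr mult.commute)
        finally have 2: "w k powr (- p) = (1 - \<rho>) powr (- p) * 2 powr (real k * \<gamma> / 2)" .
        have 3: "(2 ^ k) powr p = (2::real) powr (real k * p)"
          by (simp add: powr_powr flip: powr_realpow)
        have 4: "\<sigma> ^ k = 2 powr (real k * \<gamma> / 2) * 2 powr (real k * p) * 2 powr (- (real k * q) * \<beta>)"
        proof -
          have "\<sigma> ^ k = 2 powr (- \<gamma> / 2 * real k)"
            using \<sigma> by (simp add: powr_realpow[symmetric] \<sigma>_def powr_powr)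
          also have "- \<gamma> / 2 * real k = real k * \<gamma> / 2 + real k * p + - (real k * q) * \<beta>"
            unfolding \<gamma>_def by (simp add: algebra_simps diff_divide_distrib add_divide_distrib)
          finally show ?thesis
            by (simp only: powr_add)
        qed
        show ?thesis
          unfolding 1 2 3 4 D_def by (simp only: mult_ac)
      qed
      finally show ?thesis .
    qed
    have "power_integral p (ext Q g) \<le>
        (\<integral>\<^sup>+ z. (\<Sum>k. ennreal (norm (ext Q (f k) z / of_real (w k)) powr p)) \<partial>lborel)"
      unfolding power_integral_def
    proof (rule nn_integral_mono)
      fix z
      have "ennreal (norm (ext Q g z) powr p) \<le> ennreal ((\<Sum>k. norm (ext Q (f k) z)) powr p)"
        using ext_g \<open>p > 0\<close> by (intro ennreal_leI powr_mono2) auto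
      also have "\<dots> \<le> (\<Sum>k. ennreal ((norm (ext Q (f k) z) / w k) powr p))"
        by (intro norm_powr_le_weighted_suminf sm w \<open>p > 0\<close>) auto
      finally show "ennreal (norm (ext Q g z) powr p) \<le>
          (\<Sum>k. ennreal (norm (ext Q (f k) z / of_real (w k)) powr p))"
        using w(1) by (simp add: norm_divide abs_of_pos)
    qed
    also have "\<dots> = (\<Sum>k. power_integral p (\<lambda>z. ext Q (f k) z / of_real (w k)))"
      unfolding power_integral_def by (intro nn_integral_suminf) simp
    also have "\<dots> \<le> (\<Sum>k. ennreal (D * \<sigma> ^ k))"
      by (intro suminf_le layer summableI)
    also have "\<dots> = ennreal (D / (1 - \<sigma>))"
      using sums_mult[OF geometric_sums[of \<sigma>], of D] \<open>D \<ge> 0\<close> \<sigma>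
      by (intro suminf_ennreal_eq) auto
    finally show "power_integral p (ext Q g) \<le> ennreal (D / (1 - \<sigma>))" .
  qed
qed

section \<open>Signed sums of translates\<close>

text \<open>By Clarkson's inequality the mean of the power integrals for the two signs is at least
  the left-hand side, so the larger of them is.\<close>

lemma power_integral_ext_signed_sum:
  assumes "p \<ge> 2" and F: "integrable lborel F" and g: "integrable lborel g"
  obtains s :: complex where "s = 1 \<or> s = -1"
    "power_integral p (ext Q F) + power_integral p (ext Q g) \<le>
     power_integral p (ext Q (\<lambda>\<xi>. F \<xi> + s * g \<xi>))"
proof -
  have [measurable]: "F \<in> borel_measurable borel" "g \<in> borel_measurable borel"
    using F g by auto
  let ?X = "power_integral p (ext Q F) + power_integral p (ext Q g)"
  let ?P = "power_integral p (ext Q (\<lambda>\<xi>. F \<xi> + g \<xi>))"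
  let ?M = "power_integral p (ext Q (\<lambda>\<xi>. F \<xi> - g \<xi>))"
  have "2 * ?X \<le> ?P + ?M"
    using power_integral_clarkson[OF \<open>p \<ge> 2\<close>, of "ext Q F" "ext Q g"]
    by (simp add: ext_add[OF F g, symmetric] ext_diff[OF F g, symmetric])
  also have "\<dots> \<le> 2 * max ?P ?M"
    by (simp add: mult_2 add_mono)
  finally have "?X \<le> max ?P ?M"
    by (subst (asm) ennreal_mult_le_mult_iff) auto
  then have "?X \<le> ?P \<or> ?X \<le> ?M"
    by (simp add: le_max_iff_disj)
  then show thesis
    using that[of 1] that[of "-1"] by auto
qed

text \<open>Induction on \<open>N\<close>, adding one signed translate at a time. In the growth
  factor, 4 is the product of the 2 from \<open>exp_add_indicator_le\<close> and the 2 from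
  averaging, while 2^n is the inverse measure of the half cube from which the translation is taken.
  The crude bound by \<open>N\<close> provides support and integrability.\<close>

lemma ex_signed_translates:
  assumes "p \<ge> 2"
    and [measurable]: "g \<in> borel_measurable borel" "A \<in> sets borel"
    and A: "A \<subseteq> {\<xi>. 2 *\<^sub>R \<xi> \<in> unit_cube}" "emeasure lborel A = ennreal a" "a > 0"
    and g: "\<And>\<xi>. norm (g \<xi>) \<le> indicator A \<xi>"
  shows "\<exists>F. F \<in> borel_measurable borel \<and> (\<forall>\<xi>. norm (F \<xi>) \<le> real N * indicator unit_cube \<xi>) \<and>
    of_nat N * power_integral p (ext Q g) \<le> power_integral p (ext Q F) \<and>
    (\<integral>\<^sup>+ \<xi>. indicator unit_cube \<xi> * ennreal (exp (norm (F \<xi>))) \<partial>lborel)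
      \<le> ennreal ((1 + 4 * 2 ^ CARD('n) * a) ^ N)"
proof (induction N)
  case 0
  show ?case
    by (rule exI[of _ "\<lambda>_. 0"]) simp
next
  case (Suc N)
  let ?H = "{\<xi> :: real ^ 'n. 2 *\<^sub>R \<xi> \<in> unit_cube}"
  let ?b = "1 + 4 * 2 ^ CARD('n) * a"
  from Suc obtain F where [measurable]: "F \<in> borel_measurable borel"
    and F: "\<And>\<xi>. norm (F \<xi>) \<le> real N * indicator unit_cube \<xi>"
      "of_nat N * power_integral p (ext Q g) \<le> power_integral p (ext Q F)"
      "(\<integral>\<^sup>+ \<xi>. indicator unit_cube \<xi> * ennreal (exp (norm (F \<xi>))) \<partial>lborel) \<le> ennreal (?b ^ N)"
    by blast
  define W where "W \<xi> = indicator unit_cube \<xi> * ennreal (exp (norm (F \<xi>)))" for \<xi>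
  have [measurable]: "W \<in> borel_measurable borel"
    unfolding W_def by measurable
  obtain w where w: "(\<integral>\<^sup>+ \<xi>. W \<xi> \<partial>lborel) = ennreal w" "w \<ge> 0"
    using F(3) unfolding W_def by (cases "\<integral>\<^sup>+ \<xi>. W \<xi> \<partial>lborel") (auto simp: W_def top_unique)
  \<comment> \<open>The exponential is at least 1 on a cube of measure 1; averaging requires a
    positive total mass \<open>w\<close>.\<close>
  have "1 = (\<integral>\<^sup>+ \<xi>. indicator (unit_cube :: (real ^ 'n) set) \<xi> \<partial>lborel)"
    by simp
  also have "\<dots> \<le> (\<integral>\<^sup>+ \<xi>. W \<xi> \<partial>lborel)"
    by (intro nn_integral_mono) (auto simp: W_def indicator_def)
  finally have "w \<ge> 1"
    using w by simp
  have wb: "w \<le> ?b ^ N"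
    using F(3) w A(3) unfolding W_def[symmetric] by simp
  obtain \<eta> where \<eta>: "\<eta> \<in> ?H"
    "(\<integral>\<^sup>+ \<xi>. W \<xi> * indicator A (\<xi> - \<eta>) \<partial>lborel) \<le> ennreal (2 * a * w / (1/2) ^ CARD('n))"
    by (rule ex_translate_small_overlap[OF _ _ _ w(1) _ A(2,3) emeasure_half_cube])
       (use \<open>w \<ge> 1\<close> in auto)
  let ?g = "\<lambda>\<xi>. g (\<xi> - \<eta>)"
  have g': "norm (?g \<xi>) \<le> indicator A (\<xi> - \<eta>)" for \<xi>
    by (rule g)
  \<comment> \<open>Both \<xi> - \<eta> and \<eta> lie in the cube of side 1/2, so their sum lies in
    the unit cube.\<close>
  have shift: "indicator A (\<xi> - \<eta>) \<le> (indicator unit_cube \<xi> :: real)" for \<xi>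
  proof -
    have "\<xi> \<in> unit_cube" if "\<xi> - \<eta> \<in> A"
    proof -
      have "2 *\<^sub>R (\<xi> - \<eta>) \<in> unit_cube" using that A(1) by auto
      moreover have "2 *\<^sub>R \<eta> \<in> unit_cube" using \<eta>(1) by simp
      ultimately have "0 \<le> \<xi> $ i \<and> \<xi> $ i \<le> 1" for i
        unfolding unit_cube_def mem_box_cart by (auto dest!: spec[of _ i])
      then show ?thesis
        by (simp add: unit_cube_def mem_box_cart)
    qed
    then show ?thesis by (auto simp: indicator_def)
  qed
  have iF: "integrable lborel F"
    by (rule integrable_indicator_bounded(1)[of _ unit_cube "real N"]) (auto intro: F)
  have ig: "integrable lborel ?g"
    by (rule integrable_indicator_bounded(1)[of _ unit_cube 1]) (auto intro: order_trans[OF g' shift])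
  obtain s :: complex where s: "s = 1 \<or> s = -1"
    "power_integral p (ext Q F) + power_integral p (ext Q ?g) \<le>
     power_integral p (ext Q (\<lambda>\<xi>. F \<xi> + s * ?g \<xi>))"
    using power_integral_ext_signed_sum[OF \<open>p \<ge> 2\<close> iF ig] by blast
  let ?F = "\<lambda>\<xi>. F \<xi> + s * ?g \<xi>"
  have F': "norm (?F \<xi>) \<le> norm (F \<xi>) + indicator A (\<xi> - \<eta>)" for \<xi>
    using norm_triangle_ineq[of "F \<xi>" "s * ?g \<xi>"] g'[of \<xi>] s(1) by (auto simp: norm_mult)
  show ?case
  proof (intro exI[of _ ?F] conjI allI)
    show "?F \<in> borel_measurable borel"
      by measurable
    show "norm (?F \<xi>) \<le> real (Suc N) * indicator unit_cube \<xi>" for \<xi>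
      using F'[of \<xi>] F(1)[of \<xi>] shift[of \<xi>] by (simp add: algebra_simps)
    have "of_nat (Suc N) * power_integral p (ext Q g) =
        of_nat N * power_integral p (ext Q g) + power_integral p (ext Q ?g)"
      by (simp add: power_integral_ext_translate distrib_right add.commute)
    also have "\<dots> \<le> power_integral p (ext Q ?F)"
      using F(2) s(2) by (meson add_right_mono order_trans)
    finally show "of_nat (Suc N) * power_integral p (ext Q g) \<le> power_integral p (ext Q ?F)" .
    have "indicator unit_cube \<xi> * ennreal (exp (norm (?F \<xi>))) \<le> W \<xi> + 2 * (W \<xi> * indicator A (\<xi> - \<eta>))" for \<xi>
    proof -
      have "exp (norm (?F \<xi>)) \<le> exp (norm (F \<xi>)) * (1 + 2 * indicator A (\<xi> - \<eta>))"
        using F'[of \<xi>] exp_add_indicator_le[of "norm (F \<xi>)" A "\<xi> - \<eta>"]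
        by (meson exp_le_cancel_iff order_trans)
      then have "ennreal (exp (norm (?F \<xi>))) \<le> ennreal (exp (norm (F \<xi>)) + 2 * (exp (norm (F \<xi>)) * indicator A (\<xi> - \<eta>)))"
        by (intro ennreal_leI) (simp add: algebra_simps)
      also have "\<dots> = ennreal (exp (norm (F \<xi>))) + 2 * (ennreal (exp (norm (F \<xi>))) * indicator A (\<xi> - \<eta>))"
        by (simp add: ennreal_mult ennreal_indicator)
      finally show ?thesis
        by (auto simp: W_def indicator_def)
    qed
    then have "(\<integral>\<^sup>+ \<xi>. indicator unit_cube \<xi> * ennreal (exp (norm (?F \<xi>))) \<partial>lborel) \<le>
        (\<integral>\<^sup>+ \<xi>. W \<xi> + 2 * (W \<xi> * indicator A (\<xi> - \<eta>)) \<partial>lborel)"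
      by (intro nn_integral_mono)
    also have "\<dots> = ennreal w + 2 * (\<integral>\<^sup>+ \<xi>. W \<xi> * indicator A (\<xi> - \<eta>) \<partial>lborel)"
      by (simp add: nn_integral_add nn_integral_cmult w)
    also have "\<dots> \<le> ennreal w + 2 * ennreal (2 * a * w / (1/2) ^ CARD('n))"
      by (intro add_left_mono mult_left_mono \<eta>) auto
    also have "\<dots> = ennreal (w + 2 * (2 * a * w / (1/2) ^ CARD('n)))"
    proof -
      have "ennreal w + 2 * ennreal y = ennreal (w + 2 * y)" if "y \<ge> 0" for y
        using that w by (simp add: ennreal_mult)
      then show ?thesis
        using A w by simp
    qed
    also have "w + 2 * (2 * a * w / (1/2) ^ CARD('n)) = ?b * w"
      by (simp add: field_simps)
    also have "ennreal (?b * w) \<le> ennreal (?b ^ Suc N)"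
      unfolding power_Suc using wb A by (intro ennreal_leI mult_left_mono) auto
    finally show "(\<integral>\<^sup>+ \<xi>. indicator unit_cube \<xi> * ennreal (exp (norm (?F \<xi>))) \<partial>lborel) \<le> ennreal (?b ^ Suc N)" .
  qed
qed

section \<open>The gain of a factor |A|\<close>

text \<open>Dilate the support into the half cube, sum \<open>N\<close> signed translates, bound the
  sum \<open>F\<close> in L^q by its exponential moment, apply the L^q to L^p bound obtained from
  \<open>a = 0\<close>, divide by \<open>N\<close>, and undo the dilation at the cost of the
  constant \<open>c\<close>.\<close>

lemma restricted_type_upgrade:
  assumes C\<^sub>0: "restricted_type Q p\<^sub>0 0 C\<^sub>0" "C\<^sub>0 \<ge> 0" and p: "0 < p\<^sub>0" "p\<^sub>0 < p" "2 \<le> p"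
  obtains C where "C \<ge> 0" "restricted_type Q p 1 C"
proof -
  \<comment> \<open>Large \<open>q\<close> meets the summation condition with \<open>a = 0\<close>;
    a natural number is chosen so that \<open>power_le_fact_exp\<close> applies.\<close>
  obtain q :: nat where q: "p / (p - p\<^sub>0) < real q"
    using reals_Archimedean2 by blast
  have "0 < p / (p - p\<^sub>0)" using p by simp
  then have "q \<ge> 1" using q by (cases q) auto
  have pq: "p < real q * (p - p\<^sub>0 + real 0)"
    using q p by (simp add: field_simps)
  obtain C' where C': "C' \<ge> 0" "\<And>g. g \<in> borel_measurable borel \<Longrightarrow> (\<And>\<xi>. \<xi> \<notin> unit_cube \<Longrightarrow> g \<xi> = 0) \<Longrightarrow>
      (\<integral>\<^sup>+ \<xi>. ennreal (norm (g \<xi>) powr real q) \<partial>lborel) \<le> ennreal (fact q * exp 8) \<Longrightarrow>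
      power_integral p (ext Q g) \<le> ennreal C'"
    using restricted_type_imp_power_bounded[OF C\<^sub>0 p(1,2) _ pq, of "fact q * exp 8"] \<open>q \<ge> 1\<close>
    by (metis of_nat_1 of_nat_mono)
  obtain c where c: "c \<ge> 0" "\<And>f. f \<in> borel_measurable borel \<Longrightarrow>
      power_integral p (ext Q f) = ennreal c * power_integral p (ext Q (\<lambda>\<xi>. f (2 *\<^sub>R \<xi>)))"
    using power_integral_ext_dilate by metis
  have "restricted_type Q p 1 (c * C')"
    unfolding restricted_type_def
  proof (intro allI impI)
    fix g :: "real ^ 'n \<Rightarrow> complex" and A :: "(real ^ 'n) set"
    assume [measurable]: "g \<in> borel_measurable borel" "A \<in> sets borel"
      and A: "A \<subseteq> unit_cube" and g: "\<forall>\<xi>. norm (g \<xi>) \<le> indicator A \<xi>"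
    define a where "a = measure lborel A"
    have a: "a \<le> 1" "emeasure lborel A = ennreal a" "a \<ge> 0"
      using measure_subset_unit_cube_le[OF _ A] by (auto simp: a_def)
    show "power_integral p (ext Q g) \<le> ennreal (c * C' * measure lborel A ^ 1)"
    proof (cases "a = 0")
      case True
      have "norm (ext Q g z) \<le> 0" for z
      proof -
        have "(LINT \<xi>|lborel. norm (g \<xi>)) \<le> 1 * measure lborel A"
          by (rule integrable_indicator_bounded(2)) (use A g in auto)
        with norm_ext_le[of g z] True show ?thesis
          unfolding a_def by linarith
      qed
      then have "power_integral p (ext Q g) = 0"
        by (simp add: power_integral_def)
      then show ?thesis by simp
    next
      case False
      with a have "a > 0" by simp
      define d where "d = (2::real) ^ CARD('n)"
      have "d > 0" by (simp add: d_def)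
      let ?A = "{\<xi>. 2 *\<^sub>R \<xi> \<in> A}" and ?g = "\<lambda>\<xi>. g (2 *\<^sub>R \<xi>)"
      have "?A \<in> sets borel"
        by measurable
      have eA: "emeasure lborel ?A = ennreal (a / d)"
        using a emeasure_lborel_halve[OF \<open>A \<in> _\<close>]
        by (simp add: d_def ennreal_mult'[symmetric] power_one_over field_simps)
      \<comment> \<open>N \<ge> 1/a yields the factor \<open>a\<close> after division by
        \<open>N\<close>; N \<le> 1/a + 1 keeps a N \<le> 2.\<close>
      define N where "N = nat \<lceil>1 / a\<rceil>"
      have "0 < \<lceil>1 / a\<rceil>"
        using \<open>a > 0\<close> by simp
      then have "real N = of_int \<lceil>1 / a\<rceil>"
        by (simp add: N_def)
      then have N: "1 / a \<le> real N" "real N \<le> 1 / a + 1"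
        by linarith+
      have "\<exists>F. F \<in> borel_measurable borel \<and> (\<forall>\<xi>. norm (F \<xi>) \<le> real N * indicator unit_cube \<xi>) \<and>
        of_nat N * power_integral p (ext Q ?g) \<le> power_integral p (ext Q F) \<and>
        (\<integral>\<^sup>+ \<xi>. indicator unit_cube \<xi> * ennreal (exp (norm (F \<xi>))) \<partial>lborel)
          \<le> ennreal ((1 + 4 * 2 ^ CARD('n) * (a / d)) ^ N)"
        using A g \<open>a > 0\<close> \<open>d > 0\<close>
        by (intro ex_signed_translates[OF \<open>2 \<le> p\<close> _ \<open>?A \<in> _\<close> _ eA]) (auto simp: indicator_def)
      then obtain F where [measurable]: "F \<in> borel_measurable borel"
        and F: "\<And>\<xi>. norm (F \<xi>) \<le> real N * indicator unit_cube \<xi>"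
          "of_nat N * power_integral p (ext Q ?g) \<le> power_integral p (ext Q F)"
          "(\<integral>\<^sup>+ \<xi>. indicator unit_cube \<xi> * ennreal (exp (norm (F \<xi>))) \<partial>lborel) \<le> ennreal ((1 + 4 * 2 ^ CARD('n) * (a / d)) ^ N)"
        by blast
      have F0: "F \<xi> = 0" if "\<xi> \<notin> unit_cube" for \<xi>
        using F(1)[of \<xi>] that by simp
      \<comment> \<open>The dilated set has measure a/d, which cancels 2^n. Then (1 + 4a)^N \<le>
        exp (4 a N), and a N \<le> 2 explains the 8.\<close>
      have "(1 + 4 * 2 ^ CARD('n) * (a / d)) ^ N = (1 + 4 * a) ^ N"
        by (simp add: d_def)
      also have "\<dots> \<le> exp (4 * a) ^ N"
        using \<open>a > 0\<close> by (intro power_mono) (auto simp: add.commute)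
      also have "\<dots> = exp (4 * (a * real N))"
        by (simp add: exp_of_nat_mult[symmetric] mult_ac)
      also have "a * real N \<le> a * (1 / a + 1)"
        using N \<open>a > 0\<close> by (intro mult_left_mono) auto
      also have "\<dots> \<le> 2"
        using a \<open>a > 0\<close> by (simp add: distrib_left)
      finally have e8: "(1 + 4 * 2 ^ CARD('n) * (a / d)) ^ N \<le> exp 8"
        by simp
      have "ennreal (norm (F \<xi>) powr real q) \<le>
          ennreal (fact q) * (indicator unit_cube \<xi> * ennreal (exp (norm (F \<xi>))))" for \<xi>
      proof (cases "\<xi> \<in> unit_cube")
        case True
        have "norm (F \<xi>) powr real q = norm (F \<xi>) ^ q"
          using \<open>q \<ge> 1\<close> by (cases "F \<xi> = 0") (auto simp: powr_realpow)
        also have "\<dots> \<le> fact q * exp (norm (F \<xi>))"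
          by (rule power_le_fact_exp) simp
        finally show ?thesis
          using True by (simp add: ennreal_mult[symmetric] ennreal_leI)
      qed (simp add: F0)
      then have "(\<integral>\<^sup>+ \<xi>. ennreal (norm (F \<xi>) powr real q) \<partial>lborel) \<le>
          (\<integral>\<^sup>+ \<xi>. ennreal (fact q) * (indicator unit_cube \<xi> * ennreal (exp (norm (F \<xi>)))) \<partial>lborel)"
        by (intro nn_integral_mono)
      also have "\<dots> = ennreal (fact q) * (\<integral>\<^sup>+ \<xi>. indicator unit_cube \<xi> * ennreal (exp (norm (F \<xi>))) \<partial>lborel)"
        by (simp add: nn_integral_cmult)
      also have "\<dots> \<le> ennreal (fact q) * ennreal (exp 8)"
        using F(3) e8 by (intro mult_left_mono order_trans[OF F(3)] ennreal_leI) auto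
      finally have "power_integral p (ext Q F) \<le> ennreal C'"
        using C'(2)[of F] F0 by (simp add: ennreal_mult)
      with F(2) have NC: "ennreal (real N) * power_integral p (ext Q ?g) \<le> ennreal C'"
        by (simp add: ennreal_of_nat_eq_real_of_nat)
      have "power_integral p (ext Q ?g) = ennreal a * (ennreal (1 / a) * power_integral p (ext Q ?g))"
        using \<open>a > 0\<close> by (simp add: mult.assoc[symmetric] ennreal_mult'[symmetric])
      also have "\<dots> \<le> ennreal a * ennreal C'"
        using N by (intro mult_left_mono order_trans[OF _ NC] mult_right_mono ennreal_leI) auto
      finally have "power_integral p (ext Q ?g) \<le> ennreal (a * C')"
        using C' a by (simp add: ennreal_mult)
      then have "power_integral p (ext Q g) \<le> ennreal c * ennreal (a * C')"
        unfolding c(2)[OF \<open>g \<in> _\<close>] by (intro mult_left_mono) auto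
      then show ?thesis
        using c(1) C' a by (simp add: ennreal_mult'[symmetric] a_def mult_ac)
    qed
  qed
  moreover have "c * C' \<ge> 0" using c(1) C'(1) by simp
  ultimately show thesis using that by blast
qed

section \<open>Returning to the operator and the norms on the cube\<close>

lemma extension_op_eq_ext:
  assumes [measurable]: "f \<in> borel_measurable cube_measure" "g \<in> borel_measurable borel"
    and g: "\<And>\<xi>. \<xi> \<notin> unit_cube \<Longrightarrow> g \<xi> = 0" "AE \<xi> in cube_measure. f \<xi> = g \<xi>"
  shows "extension_op Q f = ext Q g"
proof
  fix z :: "(real ^ 'n) \<times> real"
  obtain x t where z: "z = (x, t)" by fastforce
  let ?e = "\<lambda>\<xi>. cis (x \<bullet> \<xi> + t * Q \<xi>)"
  have [measurable]: "?e \<in> borel_measurable cube_measure" "(\<lambda>\<xi>. g \<xi> * ?e \<xi>) \<in> borel_measurable cube_measure"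
    by (rule borel_measurable_cube_measureI; measurable)+
  have "extension_op Q f z = (LINT \<xi>|cube_measure. f \<xi> * ?e \<xi>)"
    by (simp add: extension_op_def z cis_conv_exp)
  also have "\<dots> = (LINT \<xi>|cube_measure. g \<xi> * ?e \<xi>)"
    using g(2) by (intro integral_cong_AE) auto
  also have "\<dots> = (LINT \<xi>|lebesgue. indicator unit_cube \<xi> *\<^sub>R (g \<xi> * ?e \<xi>))"
    by (intro integral_restrict_space) auto
  also have "\<dots> = (LINT \<xi>|lebesgue. g \<xi> * ?e \<xi>)"
    using g(1) by (intro Bochner_Integration.integral_cong) (auto simp: indicator_def)
  also have "\<dots> = ext Q g z"
    unfolding ext_def z by (simp add: integral_completion)
  finally show "extension_op Q f z = ext Q g z" .
qed

lemma Lp_norm_ext_le_iff: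
  assumes [measurable]: "g \<in> borel_measurable borel" and "p > 0" "c \<ge> 0"
  shows "Lp_norm (ennreal p) lebesgue (ext Q g) \<le> ennreal c \<longleftrightarrow>
    power_integral p (ext Q g) \<le> ennreal (c powr p)"
  using assms by (simp add: Lp_norm_def ennreal_powr_le_iff nn_integral_completion power_integral_def)

text \<open>Every point of the closed unit disc is the midpoint of two points of the unit circle.\<close>

lemma restricted_type_of_zero_or_unimodular:
  assumes "p > 0"
    and bound: "\<And>g. g \<in> zero_or_unimodular \<Longrightarrow>
      Lp_norm (ennreal p) lebesgue (extension_op Q g) \<le> ennreal C * Lp_norm \<infinity> cube_measure g"
  shows "restricted_type Q p 0 (2 * max C 0 powr p)"
  unfolding restricted_type_def
proof (intro allI impI)
  fix g :: "real ^ 'n \<Rightarrow> complex" and A :: "(real ^ 'n) set"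
  assume [measurable]: "g \<in> borel_measurable borel" "A \<in> sets borel"
    and A: "A \<subseteq> unit_cube" and g: "\<forall>\<xi>. norm (g \<xi>) \<le> indicator A \<xi>"
  define r where "r \<xi> = norm (g \<xi>)" for \<xi>
  \<comment> \<open>The polar form g = r h, with h = 1 at the zeros of \<open>g\<close>.\<close>
  define h where "h \<xi> = (if g \<xi> = 0 then 1 else g \<xi> / of_real (r \<xi>))" for \<xi>
  \<comment> \<open>The numbers r + i s sqrt(1 - r^2) for s = 1 and s = -1 are unimodular with mean
    r. The cutoff is to the whole cube rather than to \<open>A\<close>, so the resulting bound has
    \<open>a = 0\<close>.\<close>
  define u where "u s \<xi> = indicator unit_cube \<xi> *\<^sub>R (h \<xi> * Complex (r \<xi>) (s * sqrt (1 - (r \<xi>)\<^sup>2)))" for s \<xi>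
  have [measurable]: "r \<in> borel_measurable borel" "h \<in> borel_measurable borel" "u s \<in> borel_measurable borel" for s
    unfolding r_def h_def u_def Complex_eq by measurable
  have r: "0 \<le> r \<xi>" "r \<xi> \<le> 1" for \<xi>
    unfolding r_def by (auto intro: order_trans[OF g[rule_format, of \<xi>]] simp: indicator_def)
  have h: "norm (h \<xi>) = 1" "h \<xi> * of_real (r \<xi>) = g \<xi>" for \<xi>
    by (auto simp: h_def r_def norm_divide)
  have norm_u: "norm (u s \<xi>) = indicator unit_cube \<xi>" if "s = 1 \<or> s = -1" for s \<xi>
  proof -
    have "(s * sqrt (1 - (r \<xi>)\<^sup>2))\<^sup>2 = 1 - (r \<xi>)\<^sup>2"
      using that r[of \<xi>] by (auto simp: power_mult_distrib power_le_one)
    then have "norm (Complex (r \<xi>) (s * sqrt (1 - (r \<xi>)\<^sup>2))) = 1"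
      by (simp add: cmod_def)
    then show ?thesis
      by (simp add: u_def norm_mult h)
  qed
  have J: "power_integral p (ext Q (u s)) \<le> ennreal (max C 0 powr p)" if s: "s = 1 \<or> s = -1" for s
  proof -
    have u: "u s \<in> borel_measurable cube_measure"
      by (rule borel_measurable_cube_measureI) measurable
    have "u s \<in> zero_or_unimodular"
      using u norm_u[OF s] by (simp add: zero_or_unimodular_def)
    from bound[OF this]
    have "Lp_norm (ennreal p) lebesgue (extension_op Q (u s)) \<le> ennreal C * Lp_norm \<infinity> cube_measure (u s)" .
    also have "Lp_norm \<infinity> cube_measure (u s) \<le> 1"
    proof -
      have "(\<lambda>\<xi>. ennreal (norm (u s \<xi>))) \<in> borel_measurable cube_measure"
        using u by measurable
      moreover have "AE \<xi> in cube_measure. ennreal (norm (u s \<xi>)) \<le> 1"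
        by (simp add: norm_u[OF s] indicator_def)
      ultimately show ?thesis
        by (simp add: Lp_norm_def esssup_I)
    qed
    also have "extension_op Q (u s) = ext Q (u s)"
      by (rule extension_op_eq_ext[OF u]) (auto simp: u_def)
    finally have "Lp_norm (ennreal p) lebesgue (ext Q (u s)) \<le> ennreal C"
      by (simp add: mult_left_mono)
    also have "\<dots> \<le> ennreal (max C 0)"
      by (intro ennreal_leI) simp
    finally have "Lp_norm (ennreal p) lebesgue (ext Q (u s)) \<le> ennreal (max C 0)" .
    then show ?thesis
      by (subst (asm) Lp_norm_ext_le_iff) (use \<open>p > 0\<close> in auto)
  qed
  have i: "integrable lborel (u s)" if "s = 1 \<or> s = -1" for s
    by (rule integrable_indicator_bounded(1)[of _ unit_cube 1]) (auto simp: norm_u[OF that])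
  have "u 1 \<xi> + u (-1) \<xi> = 2 * g \<xi>" for \<xi>
  proof -
    have "g \<xi> = indicator unit_cube \<xi> *\<^sub>R g \<xi>"
      using g[rule_format, of \<xi>] A by (cases "\<xi> \<in> A") auto
    also have "2 * \<dots> = u 1 \<xi> + u (-1) \<xi>"
      by (simp add: u_def h(2)[symmetric] Complex_eq algebra_simps)
    finally show ?thesis by simp
  qed
  then have g_eq: "(\<lambda>\<xi>. u 1 \<xi> + u (-1) \<xi>) = (\<lambda>\<xi>. 2 * g \<xi>)" by auto
  have "ext Q (u 1) z + ext Q (u (-1)) z = 2 * ext Q g z" for z
    using ext_add[OF i i, of 1 "-1" z] by (simp add: g_eq ext_cmult)
  then have mid: "norm (ext Q g z) \<le> (norm (ext Q (u 1) z) + norm (ext Q (u (-1)) z)) / 2" for z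
    using norm_triangle_ineq[of "ext Q (u 1) z" "ext Q (u (-1)) z"] by (simp add: norm_mult)
  have "norm (ext Q g z) powr p \<le> norm (ext Q (u 1) z) powr p + norm (ext Q (u (-1)) z) powr p" for z
  proof -
    let ?a = "norm (ext Q (u 1) z)" and ?b = "norm (ext Q (u (-1)) z)"
    have "norm (ext Q g z) powr p \<le> max ?a ?b powr p"
      using mid[of z] \<open>p > 0\<close> by (intro powr_mono2) auto
    also have "\<dots> \<le> ?a powr p + ?b powr p"
      by (simp add: max_def)
    finally show ?thesis .
  qed
  then have "power_integral p (ext Q g) \<le>
      (\<integral>\<^sup>+ z. ennreal (norm (ext Q (u 1) z) powr p) + ennreal (norm (ext Q (u (-1)) z) powr p) \<partial>lborel)"
    unfolding power_integral_def by (intro nn_integral_mono) (simp flip: ennreal_plus add: ennreal_leI)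
  also have "\<dots> = power_integral p (ext Q (u 1)) + power_integral p (ext Q (u (-1)))"
    unfolding power_integral_def by (simp add: nn_integral_add)
  also have "\<dots> \<le> ennreal (max C 0 powr p) + ennreal (max C 0 powr p)"
    by (intro add_mono J) auto
  finally show "power_integral p (ext Q g) \<le> ennreal (2 * max C 0 powr p * measure lborel A ^ 0)"
    by (simp flip: ennreal_plus)
qed

section \<open>Strong type bounds for finite and infinite exponents\<close>

text \<open>The gap between \<open>p\<^sub>0\<close> and \<open>p\<close> is split at its midpoint
  \<open>p\<^sub>1\<close>: the first half is spent on reaching \<open>a = 1\<close>, the second
  makes \<open>p < p * (p - p\<^sub>1 + 1)\<close>, so the layers sum with \<open>q = p\<close>.
  Homogeneity extends the bound from normalized functions to all others.\<close>

lemma power_integral_ext_le: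
  assumes C: "restricted_type Q p\<^sub>0 0 C\<^sub>0" "C\<^sub>0 \<ge> 0" "2 \<le> p\<^sub>0" "p\<^sub>0 < p"
  obtains C where "C \<ge> 0" "\<And>g m. g \<in> borel_measurable borel \<Longrightarrow> (\<And>\<xi>. \<xi> \<notin> unit_cube \<Longrightarrow> g \<xi> = 0) \<Longrightarrow>
    (\<integral>\<^sup>+ \<xi>. ennreal (norm (g \<xi>) powr p) \<partial>lborel) = ennreal m \<Longrightarrow> m \<ge> 0 \<Longrightarrow>
    power_integral p (ext Q g) \<le> ennreal (C * m)"
proof -
  define p\<^sub>1 where "p\<^sub>1 = (p\<^sub>0 + p) / 2"
  have p\<^sub>1: "p\<^sub>0 < p\<^sub>1" "p\<^sub>1 < p" using C by (auto simp: p\<^sub>1_def)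
  obtain C\<^sub>1 where C\<^sub>1: "C\<^sub>1 \<ge> 0" "restricted_type Q p\<^sub>1 1 C\<^sub>1"
    using restricted_type_upgrade[OF C(1,2), of p\<^sub>1] C p\<^sub>1 by auto
  have "p < p * (p - p\<^sub>1 + real 1)"
    using C p\<^sub>1 by (simp add: distrib_left)
  then obtain D where D: "D \<ge> 0" "\<And>g. g \<in> borel_measurable borel \<Longrightarrow> (\<And>\<xi>. \<xi> \<notin> unit_cube \<Longrightarrow> g \<xi> = 0) \<Longrightarrow>
      (\<integral>\<^sup>+ \<xi>. ennreal (norm (g \<xi>) powr p) \<partial>lborel) \<le> ennreal 1 \<Longrightarrow>
      power_integral p (ext Q g) \<le> ennreal D"
    using restricted_type_imp_power_bounded[OF C\<^sub>1(2,1) _ p\<^sub>1(2), of p 1] C p\<^sub>1 by auto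
  show thesis
  proof (rule that[OF D(1)])
    fix g :: "real ^ 'n \<Rightarrow> complex" and m
    assume [measurable]: "g \<in> borel_measurable borel" and supp: "\<And>\<xi>. \<xi> \<notin> unit_cube \<Longrightarrow> g \<xi> = 0"
      and m: "(\<integral>\<^sup>+ \<xi>. ennreal (norm (g \<xi>) powr p) \<partial>lborel) = ennreal m" "m \<ge> 0"
    show "power_integral p (ext Q g) \<le> ennreal (D * m)"
    proof (cases "m = 0")
      \<comment> \<open>Normalization is impossible here, but \<open>g\<close> vanishes almost
        everywhere.\<close>
      case True
      then have "AE \<xi> in lborel. g \<xi> = 0"
        using m(1) by (simp add: nn_integral_0_iff_AE)
      then have "ext Q g = ext Q (\<lambda>_. 0)"
        by (intro ext_AE_cong) auto
      then show ?thesis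
        by (simp add: ext_def power_integral_def case_prod_beta')
    next
      case False
      with m have "m > 0" by simp
      define s where "s = m powr (1 / p)"
      have s: "s > 0" "s powr p = m"
        using \<open>m > 0\<close> C by (auto simp: s_def powr_powr)
      let ?h = "\<lambda>\<xi>. g \<xi> / of_real s"
      have "(\<integral>\<^sup>+ \<xi>. ennreal (norm (?h \<xi>) powr p) \<partial>lborel) =
          (\<integral>\<^sup>+ \<xi>. ennreal (1 / m) * ennreal (norm (g \<xi>) powr p) \<partial>lborel)"
        using s \<open>m > 0\<close> by (intro nn_integral_cong) (simp add: norm_divide powr_divide ennreal_mult'[symmetric])
      also have "\<dots> = ennreal (1 / m) * ennreal m"
        unfolding m(1)[symmetric] by (rule nn_integral_cmult) measurable
      also have "\<dots> = 1"
        using \<open>m > 0\<close> by (simp add: ennreal_mult'[symmetric])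
      finally have "power_integral p (ext Q ?h) \<le> ennreal D"
        by (intro D(2)) (auto simp: supp)
      moreover have "ext Q g = (\<lambda>z. of_real s * ext Q ?h z)"
      proof
        show "ext Q g z = of_real s * ext Q ?h z" for z
          using s(1) by (simp add: ext_cmult[of "of_real s" ?h, symmetric])
      qed
      ultimately have "power_integral p (ext Q g) \<le> ennreal m * ennreal D"
        using s by (simp add: power_integral_cmult mult_left_mono)
      then show ?thesis
        using D(1) m by (simp add: ennreal_mult'[symmetric] mult.commute)
    qed
  qed
qed

text \<open>The case of an infinite exponent: |E g| is at most the L^1 norm of \<open>g\<close>,
  which on a cube of measure 1 is at most the supremum norm.\<close>

lemma Lp_norm_infinity_extension_op_le:
  assumes "g \<in> Lp_space \<infinity> cube_measure"
  shows "Lp_norm \<infinity> lebesgue (extension_op Q g) \<le> Lp_norm \<infinity> cube_measure g"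
proof -
  have [measurable]: "g \<in> borel_measurable cube_measure" and fin: "Lp_norm \<infinity> cube_measure g < \<infinity>"
    using assms by (auto simp: Lp_space_def)
  obtain m where m: "Lp_norm \<infinity> cube_measure g = ennreal m" "m \<ge> 0"
    using fin by (cases "Lp_norm \<infinity> cube_measure g") auto
  obtain h where [measurable]: "h \<in> borel_measurable borel"
    and h: "\<And>\<xi>. \<xi> \<notin> unit_cube \<Longrightarrow> h \<xi> = 0" "AE \<xi> in cube_measure. g \<xi> = h \<xi>"
    using cube_measure_borel_representative[of g] by auto
  have "AE \<xi> in cube_measure. ennreal (norm (g \<xi>)) \<le> ennreal m"
    using esssup_AE[of "\<lambda>\<xi>. ennreal (norm (g \<xi>))" cube_measure] m by (simp add: Lp_norm_def)
  then have bd: "AE \<xi> in cube_measure. ennreal (norm (h \<xi>)) \<le> ennreal m"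
    using h(2) by eventually_elim simp
  have "(\<integral>\<^sup>+ \<xi>. ennreal (norm (h \<xi>)) \<partial>lborel) = (\<integral>\<^sup>+ \<xi>. ennreal (norm (h \<xi>)) \<partial>cube_measure)"
    using h(1) by (intro nn_integral_cube_measure[symmetric]) auto
  also have "\<dots> \<le> (\<integral>\<^sup>+ \<xi>. ennreal m \<partial>(cube_measure :: (real ^ 'n) measure))"
    using bd by (rule nn_integral_mono_AE)
  also have "\<dots> = ennreal m"
    by (simp add: emeasure_restrict_space)
  finally have "(LINT \<xi>|lborel. norm (h \<xi>)) \<le> m"
    using m(2) by (subst integral_eq_nn_integral) (auto intro: enn2real_leI)
  then have "norm (ext Q h z) \<le> m" for z
    using norm_ext_le[of h z] by simp
  then have "Lp_norm \<infinity> lebesgue (ext Q h) \<le> ennreal m"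
    unfolding Lp_norm_def by (auto intro!: esssup_I measurable_completion ennreal_leI)
  then show ?thesis
    using extension_op_eq_ext[OF _ _ h] m(1) by simp
qed

end

theorem corollary1p4:
  fixes Q :: "real ^ 'n \<Rightarrow> real" and p\<^sub>0 :: ennreal
  assumes "quadratic_form Q"
    and "p\<^sub>0 > ennreal ((2 * real CARD('n) + 2) / real CARD('n))"
    and "\<exists>C::real. \<forall>g\<in>zero_or_unimodular.
           Lp_norm p\<^sub>0 lebesgue (extension_op Q g) \<le> ennreal C * Lp_norm \<infinity> cube_measure g"
  shows "\<forall>p>p\<^sub>0. \<exists>C'::real. \<forall>g\<in>Lp_space p cube_measure.
           Lp_norm p lebesgue (extension_op Q g) \<le> ennreal C' * Lp_norm p cube_measure g"
proof (intro allI impI)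
  fix p :: ennreal assume "p > p\<^sub>0"
  show "\<exists>C'::real. \<forall>g\<in>Lp_space p cube_measure.
      Lp_norm p lebesgue (extension_op Q g) \<le> ennreal C' * Lp_norm p cube_measure g"
  proof (cases p)
    case top
    then show ?thesis
      using Lp_norm_infinity_extension_op_le[OF assms(1)] by (intro exI[of _ 1]) simp
  next
    case (real P)
    obtain P\<^sub>0 where P\<^sub>0: "p\<^sub>0 = ennreal P\<^sub>0" "P\<^sub>0 \<ge> 0"
      using \<open>p > p\<^sub>0\<close> by (cases p\<^sub>0) auto
    \<comment> \<open>The threshold is 2 + 2/n, so the exponents lie in the range p \<ge> 2 of
      Clarkson's inequality.\<close>
    have "2 \<le> (2 * real CARD('n) + 2) / real CARD('n)"
      by (simp add: field_simps)
    also have "\<dots> < P\<^sub>0"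
      using assms(2) by (simp add: P\<^sub>0 ennreal_less_iff)
    finally have "2 \<le> P\<^sub>0" by simp
    have "P\<^sub>0 < P"
      using \<open>p > p\<^sub>0\<close> real P\<^sub>0 by (simp add: ennreal_less_iff)
    have "P > 0" using \<open>2 \<le> P\<^sub>0\<close> \<open>P\<^sub>0 < P\<close> by simp
    obtain C where "\<And>g. g \<in> zero_or_unimodular \<Longrightarrow>
        Lp_norm (ennreal P\<^sub>0) lebesgue (extension_op Q g) \<le> ennreal C * Lp_norm \<infinity> cube_measure g"
      using assms(3) P\<^sub>0 by auto
    then have "restricted_type Q P\<^sub>0 0 (2 * max C 0 powr P\<^sub>0)"
      using \<open>2 \<le> P\<^sub>0\<close> by (intro restricted_type_of_zero_or_unimodular[OF assms(1)]) auto
    then obtain D where D: "D \<ge> 0" "\<And>g m. g \<in> borel_measurable borel \<Longrightarrow> (\<And>\<xi>. \<xi> \<notin> unit_cube \<Longrightarrow> g \<xi> = 0) \<Longrightarrow>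
        (\<integral>\<^sup>+ \<xi>. ennreal (norm (g \<xi>) powr P) \<partial>lborel) = ennreal m \<Longrightarrow> m \<ge> 0 \<Longrightarrow>
        power_integral P (ext Q g) \<le> ennreal (D * m)"
      by (rule power_integral_ext_le[OF assms(1) _ _ \<open>2 \<le> P\<^sub>0\<close> \<open>P\<^sub>0 < P\<close>]) auto
    show ?thesis
    \<comment> \<open>\<open>D\<close> bounds p-th powers, so its root is the constant for the
      norms.\<close>
    proof (intro exI[of _ "D powr (1 / P)"] ballI)
      fix g :: "real ^ 'n \<Rightarrow> complex" assume "g \<in> Lp_space p cube_measure"
      then have [measurable]: "g \<in> borel_measurable cube_measure" and fin: "Lp_norm p cube_measure g < \<infinity>"
        by (auto simp: Lp_space_def)
      obtain h where [measurable]: "h \<in> borel_measurable borel"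
        and h: "\<And>\<xi>. \<xi> \<notin> unit_cube \<Longrightarrow> h \<xi> = 0" "AE \<xi> in cube_measure. g \<xi> = h \<xi>"
        using cube_measure_borel_representative[of g] by auto
      have "(\<integral>\<^sup>+ \<xi>. ennreal (norm (g \<xi>) powr P) \<partial>cube_measure) =
          (\<integral>\<^sup>+ \<xi>. ennreal (norm (h \<xi>) powr P) \<partial>cube_measure)"
        using h(2) by (intro nn_integral_cong_AE) auto
      also have "\<dots> = (\<integral>\<^sup>+ \<xi>. ennreal (norm (h \<xi>) powr P) \<partial>lborel)"
        using h(1) by (intro nn_integral_cube_measure) auto
      finally have Lp_g: "Lp_norm p cube_measure g =
          ennreal_powr (\<integral>\<^sup>+ \<xi>. ennreal (norm (h \<xi>) powr P) \<partial>lborel) (1 / P)"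
        using real by (simp add: Lp_norm_def)
      then obtain m where m: "(\<integral>\<^sup>+ \<xi>. ennreal (norm (h \<xi>) powr P) \<partial>lborel) = ennreal m" "m \<ge> 0"
        using fin by (cases "\<integral>\<^sup>+ \<xi>. ennreal (norm (h \<xi>) powr P) \<partial>lborel") (auto simp: ennreal_powr_def)
      have "power_integral P (ext Q h) \<le> ennreal (D * m)"
        by (intro D(2) h m) simp
      then have "Lp_norm (ennreal P) lebesgue (ext Q h) \<le> ennreal ((D * m) powr (1 / P))"
        using D(1) m(2) \<open>P > 0\<close> by (subst Lp_norm_ext_le_iff[OF assms(1)]) (auto simp: powr_powr)
      also have "\<dots> = ennreal (D powr (1 / P)) * Lp_norm p cube_measure g"
        using D(1) m by (simp add: Lp_g ennreal_powr_def powr_mult ennreal_mult)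
      finally show "Lp_norm p lebesgue (extension_op Q g) \<le> ennreal (D powr (1 / P)) * Lp_norm p cube_measure g"
        using extension_op_eq_ext[OF assms(1) _ _ h] real by simp
    qed
  qed
qed

end
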